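(* Let $\alpha\in(0,1)$, $\sigma=1-\alpha/2$, and let $\Omega\subset\mathbb R^d$ be a bounded Lipschitz domain. Let $0=t_0<t_1<t_2<\cdots$ be a time mesh with steps $\tau_j=t_j-t_{j-1}$ and step ratios $\rho_j=\tau_j/\tau_{j-1}$ ($j\ge 2$), and suppose that for every $k\ge 2$: $$\rho_*<\rho_{k+1}\le \frac{\rho_k^2(1+\rho_k)}{1-3\rho_k^2(1+\rho_k)}\ \text{ if } \rho_*<\rho_k<\eta,\qquad \rho_*<\rho_{k+1}\ \text{ if } \eta\le\rho_k,$$ (in particular $\rho_k>\rho_*$ for all $k\ge2$), where $\rho_*$ and $\eta$ are as defined in the context. Then for every sequence $u=(u^0,u^1,u^2,\dots)$ of functions in $L^2(\Omega)$ and every $n\ge 1$, $$\mathcal B_n(u,u):=\sum_{k=1}^n\langle L_k^{\alpha,*}u,\delta_k u\rangle\ \ge\ \sum_{k=1}^n\frac{g_k(\alpha)}{2\Gamma(2-\alpha)}\|\delta_k u\|_{L^2(\Omega)}^2\ \ge 0,$$ where $\langle\cdot,\cdot\rangle$ is the $L^2(\Omega)$ inner product and $$g_k(\alpha)=\begin{cases}\dfrac{1}{(\sigma\tau_1)^\alpha}\Big(2\sigma-\dfrac{1-\alpha}{\rho_2^\alpha}\Big), & k=1,\\[2mm] (1-\alpha)c_{k-1}^k+\dfrac{1}{(\sigma\tau_k)^\alpha}\Big(1-\dfrac{\alpha(1-\alpha)}{(1+\rho_{k+1})\rho_{k+1}^\alpha}\displaystyle\int_0^1\frac{s(\rho_{k+1}+s)}{\sigma\rho_{k+1}+s}\,\mathrm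 ds\Big), & 2\le k\le n-1,\\[2mm] (1-\alpha)c_{n-1}^n+\dfrac{1}{(\sigma\tau_n)^\alpha}, & k=n\neq 2.\end{cases}$$ Moreover, these $g_k(\alpha)$ are positive for all $\alpha\in(0,1)$.
   Context: Notation: $t_k^*=t_{k-1}+\sigma\tau_k$. For $k\ge2$ and $1\le j\le k-1$ define $$a_j^k=\int_0^1\frac{-2\tau_j(1-\theta)-\tau_{j+1}}{(\tau_j+\tau_{j+1})\,(t_k^*-t_{j-1}-\theta\tau_j)^\alpha}\,\mathrm d\theta,\qquad c_j^k=\int_0^1\frac{\tau_j^2(2\theta-1)}{\tau_{j+1}(\tau_j+\tau_{j+1})\,(t_k^*-t_{j-1}-\theta\tau_j)^\alpha}\,\mathrm d\theta,$$ and $d_j^k=c_{j-1}^k-a_j^k$ for $2\le j\le k-1$; by convention $a_1^1=0$, $c_0^1=0$. For a sequence $u=(u^0,u^1,\dots)$ set $\delta_j u=u^j-u^{j-1}$ and define the L2-1$_\sigma$ discrete fractional derivative, for $k\ge1$, $$L_k^{\alpha,*}u=\frac{1}{\Gamma(1-\alpha)}\Big(c_{k-1}^k\delta_k u-a_1^k\delta_1u+\sum_{j=2}^{k-1}d_j^k\delta_j u\Big)+\frac{\sigma^{1-\alpha}}{\Gamma(2-\alpha)\tau_k^\alpha}\delta_k u.$$ $\rho_*\approx 0.356341$ is the unique positive root of $\rho(1+\rho)=1-3\rho^2(1+\rho)$, and $\eta\approx0.475329$ is the unique positive root of $1-3\rho^2(1+\rho)=0$.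
   Formalization: The last case of g_k is read as "k = n ≠ 1" instead of "k = n ≠ 2", since otherwise g_2 is undefined for n = 2; for n = 1 the k = 1 formula is used. *)

theory Defs
  imports "HOL-Analysis.Analysis"
begin

definition lipschitz_domain :: "'a::euclidean_space set \<Rightarrow> bool" where
  "lipschitz_domain \<Omega> \<longleftrightarrow> open \<Omega> \<and> bounded \<Omega> \<and> connected \<Omega> \<and> \<Omega> \<noteq> {} \<and>
     (\<forall>x\<in>frontier \<Omega>. \<exists>r>0. \<exists>e::'a. norm e = 1 \<and>
        (\<exists>(h::'a \<Rightarrow> real) L. L-lipschitz_on UNIV h \<and>
           \<Omega> \<inter> ball x r = {y \<in> ball x r. y \<bullet> e < h (y - (y \<bullet> e) *\<^sub>R e)}))"

definition in_L2 :: "'a::euclidean_space set \<Rightarrow> ('a \<Rightarrow> real) \<Rightarrow> bool" where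
  "in_L2 \<Omega> f \<longleftrightarrow> (\<lambda>x. indicator \<Omega> x * f x) \<in> borel_measurable lborel \<and>
                   set_integrable lborel \<Omega> (\<lambda>x. (f x)\<^sup>2)"

definition L2_inner :: "'a::euclidean_space set \<Rightarrow> ('a \<Rightarrow> real) \<Rightarrow> ('a \<Rightarrow> real) \<Rightarrow> real" where
  "L2_inner \<Omega> f g = (LINT x:\<Omega>|lborel. f x * g x)"

definition L2_norm_sq :: "'a::euclidean_space set \<Rightarrow> ('a \<Rightarrow> real) \<Rightarrow> real" where
  "L2_norm_sq \<Omega> f = (LINT x:\<Omega>|lborel. (f x)\<^sup>2)"

definition rho_star :: real where
  "rho_star = (THE \<rho>. \<rho> > 0 \<and> \<rho> * (1 + \<rho>) = 1 - 3 * \<rho>\<^sup>2 * (1 + \<rho>))"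

definition eta :: real where
  "eta = (THE \<rho>. \<rho> > 0 \<and> 1 - 3 * \<rho>\<^sup>2 * (1 + \<rho>) = 0)"

definition sigma :: "real \<Rightarrow> real" where
  "sigma \<alpha> = 1 - \<alpha> / 2"

definition tau :: "(nat \<Rightarrow> real) \<Rightarrow> nat \<Rightarrow> real" where
  "tau t j = t j - t (j - 1)"

definition ratio :: "(nat \<Rightarrow> real) \<Rightarrow> nat \<Rightarrow> real" where
  "ratio t j = tau t j / tau t (j - 1)"

definition tstar :: "real \<Rightarrow> (nat \<Rightarrow> real) \<Rightarrow> nat \<Rightarrow> real" where
  "tstar \<alpha> t k = t (k - 1) + sigma \<alpha> * tau t k"

text \<open>a_j^k for 1 <= j <= k-1, and 0 otherwise (covers the convention a_1^1 = 0).\<close>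
definition acoef :: "real \<Rightarrow> (nat \<Rightarrow> real) \<Rightarrow> nat \<Rightarrow> nat \<Rightarrow> real" where
  "acoef \<alpha> t k j = (if 1 \<le> j \<and> j \<le> k - 1 then
     integral {0..1} (\<lambda>\<theta>. (- 2 * tau t j * (1 - \<theta>) - tau t (j + 1)) /
        ((tau t j + tau t (j + 1)) * (tstar \<alpha> t k - t (j - 1) - \<theta> * tau t j) powr \<alpha>))
     else 0)"

text \<open>c_j^k for 1 <= j <= k-1, and 0 otherwise (covers the convention c_0^1 = 0).\<close>
definition ccoef :: "real \<Rightarrow> (nat \<Rightarrow> real) \<Rightarrow> nat \<Rightarrow> nat \<Rightarrow> real" where
  "ccoef \<alpha> t k j = (if 1 \<le> j \<and> j \<le> k - 1 then
     integral {0..1} (\<lambda>\<theta>. (tau t j)\<^sup>2 * (2 * \<theta> - 1) /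
        (tau t (j + 1) * (tau t j + tau t (j + 1)) * (tstar \<alpha> t k - t (j - 1) - \<theta> * tau t j) powr \<alpha>))
     else 0)"

definition dcoef :: "real \<Rightarrow> (nat \<Rightarrow> real) \<Rightarrow> nat \<Rightarrow> nat \<Rightarrow> real" where
  "dcoef \<alpha> t k j = ccoef \<alpha> t k (j - 1) - acoef \<alpha> t k j"

definition delta :: "(nat \<Rightarrow> 'a \<Rightarrow> real) \<Rightarrow> nat \<Rightarrow> 'a \<Rightarrow> real" where
  "delta u j = (\<lambda>x. u j x - u (j - 1) x)"

definition Lstar :: "real \<Rightarrow> (nat \<Rightarrow> real) \<Rightarrow> (nat \<Rightarrow> 'a \<Rightarrow> real) \<Rightarrow> nat \<Rightarrow> 'a \<Rightarrow> real" where
  "Lstar \<alpha> t u k = (\<lambda>x.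
     (1 / Gamma (1 - \<alpha>)) * (ccoef \<alpha> t k (k - 1) * delta u k x - acoef \<alpha> t k 1 * delta u 1 x
        + (\<Sum>j = 2..k - 1. dcoef \<alpha> t k j * delta u j x))
     + sigma \<alpha> powr (1 - \<alpha>) / (Gamma (2 - \<alpha>) * tau t k powr \<alpha>) * delta u k x)"

definition Bform :: "real \<Rightarrow> (nat \<Rightarrow> real) \<Rightarrow> 'a::euclidean_space set \<Rightarrow> (nat \<Rightarrow> 'a \<Rightarrow> real) \<Rightarrow> nat \<Rightarrow> real" where
  "Bform \<alpha> t \<Omega> u n = (\<Sum>k = 1..n. L2_inner \<Omega> (Lstar \<alpha> t u k) (delta u k))"

definition gcoef :: "real \<Rightarrow> (nat \<Rightarrow> real) \<Rightarrow> nat \<Rightarrow> nat \<Rightarrow> real" where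
  "gcoef \<alpha> t n k =
    (if k = 1 then
       (1 / (sigma \<alpha> * tau t 1) powr \<alpha>) * (2 * sigma \<alpha> - (1 - \<alpha>) / ratio t 2 powr \<alpha>)
     else if k = n then
       (1 - \<alpha>) * ccoef \<alpha> t k (k - 1) + 1 / (sigma \<alpha> * tau t k) powr \<alpha>
     else
       (1 - \<alpha>) * ccoef \<alpha> t k (k - 1) + (1 / (sigma \<alpha> * tau t k) powr \<alpha>) *
         (1 - \<alpha> * (1 - \<alpha>) / ((1 + ratio t (k + 1)) * ratio t (k + 1) powr \<alpha>) *
            integral {0..1} (\<lambda>s. s * (ratio t (k + 1) + s) / (sigma \<alpha> * ratio t (k + 1) + s))))"

end

theory Submission
  imports Defs
begin

text \<open>
  After multiplication by $2\Gamma(2-\alpha)/(1-\alpha)$, the difference of the two sides is, at each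
  point of the domain, a quadratic form in the increments with a symmetric matrix $S$. Writing each
  row through the tail sums $v_j + \dots + v_k$, the form is nonnegative as soon as
  $S_{k,j} - S_{k,j-1}$ is nonincreasing in $k$ and nonnegative in the last row. Both conditions are
  one statement about the functional
  $\psi \mapsto c_{j-1} + \psi(t_{j-1}) - c_{j-2} + a_{j-1}$, namely that it is nonnegative on
  increasing convex $\psi$, applied to $\psi = (t_k^* - x)^{-\alpha}$ and to the difference of two
  consecutive such kernels. On such $\psi$ one compares with the tangent slope at $t_{j-2}$, and the
  step-ratio hypothesis, in the form $1/(\rho_k^2(1+\rho_k)) \le 3 + 1/\rho_{k+1}$, makes the two
  sides balance. The integral in $g_k$ is the remainder of one integration by parts, estimated by
  freezing $(\sigma\rho+s)^{-\alpha}$ at $s=0$. Positivity of $g_k$ needs only $\rho_* > 1/3$.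
\<close>

section \<open>Quadratic forms\<close>

text \<open>Summation by parts: \<open>v j\<close> occurs in the tails with \<open>a <= j\<close>,
  and those increments of \<open>s\<close> telescope to \<open>s j\<close>. The last tail is empty;
  it is kept so that the range matches the columns of row \<open>Suc K\<close>.\<close>

lemma abel_tail_sum:
  fixes s v :: "nat \<Rightarrow> real"
  assumes "s 0 = 0"
  shows "(\<Sum>a=1..Suc K. (s a - s (a - 1)) * (\<Sum>i=a..K. v i)) = (\<Sum>j=1..K. s j * v j)"
proof (induction K)
  case 0
  then show ?case by simp
next
  case (Suc K)
  have tele: "(\<Sum>a=1..m. s a - s (a - 1)) = s m" for m
    by (induction m) (auto simp: assms)
  have "(\<Sum>a=1..Suc (Suc K). (s a - s (a - 1)) * (\<Sum>i=a..Suc K. v i))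
      = (\<Sum>a=1..Suc K. (s a - s (a - 1)) * (\<Sum>i=a..Suc K. v i))"
    by simp
  also have "\<dots> = (\<Sum>a=1..Suc K. (s a - s (a - 1)) * (\<Sum>i=a..K. v i) + (s a - s (a - 1)) * v (Suc K))"
    by (intro sum.cong) (auto simp: algebra_simps)
  also have "\<dots> = (\<Sum>j=1..K. s j * v j) + (\<Sum>a=1..Suc K. s a - s (a - 1)) * v (Suc K)"
    by (simp only: sum.distrib Suc.IH sum_distrib_right)
  finally show ?case by (simp only: tele) simp
qed

text \<open>With \<open>P a k\<close> the tail sum, \<open>v k = P a k - P a (k - 1)\<close> for
  every \<open>a <= k\<close>, so the square of \<open>v k\<close> plus
  \<open>2 * v k * P a (k - 1)\<close> is a difference of squares. Each row is a combination of such
  differences, and summation by parts in \<open>k\<close> leaves nonnegative multiples of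
  squares.\<close>

lemma quadratic_form_nonneg:
  fixes S :: "nat \<Rightarrow> nat \<Rightarrow> real" and v :: "nat \<Rightarrow> real"
  assumes S0: "\<And>k. S k 0 = 0"
    and dec: "\<And>k a. 1 \<le> a \<Longrightarrow> a \<le> k \<Longrightarrow> k < n \<Longrightarrow>
                S (Suc k) a - S (Suc k) (a - 1) \<le> S k a - S k (a - 1)"
    and nonneg: "\<And>a. 1 \<le> a \<Longrightarrow> a \<le> n \<Longrightarrow> S n (a - 1) \<le> S n a"
  shows "0 \<le> (\<Sum>k=1..n. S k k * (v k)\<^sup>2 + 2 * v k * (\<Sum>j=1..k-1. S k j * v j))"
proof -
  define P where "P a k = (\<Sum>i=a..k. v i)" for a k
  define e where "e k a = S k a - S k (a - 1)" for k a
  define row where "row k = S k k * (v k)\<^sup>2 + 2 * v k * (\<Sum>j=1..k-1. S k j * v j)" for k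
  have row: "row (Suc K) = (\<Sum>a=1..Suc K. e (Suc K) a * ((P a (Suc K))\<^sup>2 - (P a K)\<^sup>2))" for K
  proof -
    have tele: "(\<Sum>a=1..m. e (Suc K) a) = S (Suc K) m" for m
      unfolding e_def by (induction m) (auto simp: S0)
    have "(\<Sum>a=1..Suc K. e (Suc K) a * ((P a (Suc K))\<^sup>2 - (P a K)\<^sup>2))
        = (\<Sum>a=1..Suc K. e (Suc K) a * (v (Suc K))\<^sup>2 + 2 * v (Suc K) * (e (Suc K) a * P a K))"
      by (intro sum.cong refl) (auto simp: P_def power2_eq_square algebra_simps)
    also have "\<dots> = (\<Sum>a=1..Suc K. e (Suc K) a) * (v (Suc K))\<^sup>2
                  + 2 * v (Suc K) * (\<Sum>a=1..Suc K. e (Suc K) a * P a K)"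
      by (simp only: sum.distrib sum_distrib_left sum_distrib_right)
    also have "(\<Sum>a=1..Suc K. e (Suc K) a * P a K) = (\<Sum>j=1..K. S (Suc K) j * v j)"
      unfolding e_def P_def by (rule abel_tail_sum) (rule S0)
    finally show ?thesis by (simp only: tele row_def) simp
  qed
  \<comment> \<open>The induction carries the squares weighted by row \<open>m\<close>;
    \<open>dec\<close> then lowers these weights to those of row \<open>Suc m\<close>.\<close>
  have main: "m \<le> n \<Longrightarrow> (\<Sum>a=1..m. e m a * (P a m)\<^sup>2) \<le> (\<Sum>k=1..m. row k)" for m
  proof (induction m)
    case 0
    then show ?case by simp
  next
    case (Suc m)
    have "(\<Sum>a=1..m. e (Suc m) a * (P a m)\<^sup>2) \<le> (\<Sum>a=1..m. e m a * (P a m)\<^sup>2)"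
      using Suc.prems by (intro sum_mono mult_right_mono) (auto simp: e_def dec[simplified])
    also have "\<dots> \<le> (\<Sum>k=1..m. row k)" using Suc by simp
    \<comment> \<open>The new column \<open>a = Suc m\<close> starts from an empty tail and has no
      earlier square to subtract.\<close>
    moreover have "P (Suc m) m = 0" by (simp add: P_def)
    ultimately show ?case
      by (simp add: row sum_subtractf right_diff_distrib)
  qed
  have "0 \<le> (\<Sum>a=1..n. e n a * (P a n)\<^sup>2)"
    by (intro sum_nonneg mult_nonneg_nonneg) (auto simp: e_def nonneg[simplified])
  with main[of n] show ?thesis unfolding row_def by linarith
qed

section \<open>Moments on the unit interval\<close>

text \<open>For positive \<open>p\<close>, \<open>q\<close> a probability density on the unit
  interval. With two consecutive steps for \<open>p\<close> and \<open>q\<close> it is minus the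
  rational factor in the integrand of \<open>acoef\<close>, which makes \<open>Aint\<close> a mean
  value.\<close>

definition weight :: "real \<Rightarrow> real \<Rightarrow> real \<Rightarrow> real" where
  "weight p q \<theta> = (2 * p * (1 - \<theta>) + q) / (p + q)"

definition Aint :: "real \<Rightarrow> real \<Rightarrow> (real \<Rightarrow> real) \<Rightarrow> real" where
  "Aint p q f = integral {0..1} (\<lambda>\<theta>. weight p q \<theta> * f \<theta>)"

text \<open>The factor \<open>2 * \<theta> - 1\<close> has mean zero, so constants drop out and only
  the growth of \<open>f\<close> counts.\<close>

definition Cint :: "real \<Rightarrow> real \<Rightarrow> (real \<Rightarrow> real) \<Rightarrow> real" where
  "Cint p q f = p\<^sup>2 / (q * (p + q)) * integral {0..1} (\<lambda>\<theta>. (2 * \<theta> - 1) * f \<theta>)"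

lemma weight_nonneg: "0 < p \<Longrightarrow> 0 < q \<Longrightarrow> \<theta> \<le> 1 \<Longrightarrow> 0 \<le> weight p q \<theta>"
  by (simp add: weight_def)

lemma weight_has_integral:
  assumes "0 < p" "0 < q"
  shows "((\<lambda>\<theta>. weight p q \<theta> * (a - M * (1 - \<theta>))) has_integral
           a - M * (2 * p / 3 + q / 2) / (p + q)) {0..1}"
proof -
  \<comment> \<open>This is \<open>p + q\<close> times an antiderivative, written in powers of
    \<open>1 - \<theta>\<close> so that \<open>F 1 = 0\<close>.\<close>
  define F where "F \<theta> = a * (- p * (1 - \<theta>)^2 - q * (1 - \<theta>))
      - M * (- p * (2 / 3 * (1 - \<theta>)^3) - q * (1 / 2 * (1 - \<theta>)^2))" for \<theta>
  have "((\<lambda>\<theta>. weight p q \<theta> * (a - M * (1 - \<theta>))) has_integral F 1 / (p + q) - F 0 / (p + q)) {0..1}"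
  proof (rule fundamental_theorem_of_calculus)
    fix x :: real
    have "(F has_real_derivative (2 * p * (1 - x) + q) * (a - M * (1 - x))) (at x)"
      unfolding F_def
      by (auto intro!: derivative_eq_intros simp: power2_eq_square field_simps)
    then have "((\<lambda>x. F x / (p + q)) has_real_derivative weight p q x * (a - M * (1 - x))) (at x)"
      using DERIV_cdivide by (fastforce simp: weight_def)
    then show "((\<lambda>x. F x / (p + q)) has_vector_derivative weight p q x * (a - M * (1 - x))) (at x within {0..1})"
      by (simp add: has_real_derivative_iff_has_vector_derivative[symmetric] has_field_derivative_at_within)
  qed simp
  moreover have "F 1 / (p + q) - F 0 / (p + q) = a - M * (2 * p / 3 + q / 2) / (p + q)"
    unfolding F_def using assms by (simp add: field_simps)
  ultimately show ?thesis by simp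
qed

text \<open>The line of slope \<open>M\<close> through the value of \<open>f\<close> at
  \<open>1/2\<close> lies above \<open>f\<close> on the left half and below it on the right half.
  The factor \<open>2 * \<theta> - 1\<close> changes sign at the same point, so replacing
  \<open>f\<close> by the line lowers the integrand everywhere. Twice the variance
  \<open>1/12\<close> gives the constant \<open>1/6\<close>.\<close>

lemma moment_ge:
  fixes f :: "real \<Rightarrow> real"
  assumes cont: "continuous_on {0..1} f"
    and slope: "\<And>x y. 0 \<le> x \<Longrightarrow> x \<le> y \<Longrightarrow> y \<le> 1 \<Longrightarrow> M * (y - x) \<le> f y - f x"
  shows "M / 6 \<le> integral {0..1} (\<lambda>\<theta>. (2 * \<theta> - 1) * f \<theta>)"
proof -
  \<comment> \<open>The antiderivative for the line; its first summand vanishes at both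
    ends.\<close>
  define F where "F x = f (1/2) * (x^2 - x) + M * (2 * x - 1)^3 / 12" for x
  have "((\<lambda>x. (2 * x - 1) * (f (1/2) + M * (x - 1/2))) has_integral F 1 - F 0) {0..1}"
  proof (rule fundamental_theorem_of_calculus)
    fix x :: real
    have "(F has_real_derivative (2 * x - 1) * (f (1/2) + M * (x - 1/2))) (at x)"
      unfolding F_def
      by (auto intro!: derivative_eq_intros simp: field_simps power2_eq_square)
    then show "(F has_vector_derivative (2 * x - 1) * (f (1/2) + M * (x - 1/2))) (at x within {0..1})"
      by (simp add: has_real_derivative_iff_has_vector_derivative[symmetric] has_field_derivative_at_within)
  qed simp
  then have "((\<lambda>x. (2 * x - 1) * (f (1/2) + M * (x - 1/2))) has_integral M / 6) {0..1}"
    by (simp add: F_def)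
  then show ?thesis
  proof (rule has_integral_le)
    show "((\<lambda>\<theta>. (2 * \<theta> - 1) * f \<theta>) has_integral integral {0..1} (\<lambda>\<theta>. (2 * \<theta> - 1) * f \<theta>)) {0..1}"
      by (intro integrable_integral integrable_continuous_real continuous_intros cont)
    fix x :: real assume x: "x \<in> {0..1}"
    show "(2 * x - 1) * (f (1/2) + M * (x - 1/2)) \<le> (2 * x - 1) * f x"
    proof (cases "x \<le> 1/2")
      case True
      then show ?thesis using slope[of x "1/2"] x
        by (intro mult_left_mono_neg) (auto simp: algebra_simps)
    next
      case False
      then show ?thesis using slope[of "1/2" x] x
        by (intro mult_left_mono) (auto simp: algebra_simps)
    qed
  qed
qed

lemma moment_le:
  fixes f :: "real \<Rightarrow> real"
  assumes "continuous_on {0..1} f"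
    and "\<And>x y. 0 \<le> x \<Longrightarrow> x \<le> y \<Longrightarrow> y \<le> 1 \<Longrightarrow> f y - f x \<le> M * (y - x)"
  shows "integral {0..1} (\<lambda>\<theta>. (2 * \<theta> - 1) * f \<theta>) \<le> M / 6"
  using moment_ge[of "\<lambda>x. - f x" "- M"] assms by (force intro: continuous_intros)

lemma Aint_integrable:
  "continuous_on {0..1} f \<Longrightarrow> (\<lambda>\<theta>. weight p q \<theta> * f \<theta>) integrable_on {0..1}"
  unfolding weight_def divide_inverse by (intro integrable_continuous_real continuous_intros)

lemma Aint_mono:
  assumes "0 < p" "0 < q" "continuous_on {0..1} f" "continuous_on {0..1} g"
    and "\<And>x. 0 \<le> x \<Longrightarrow> x \<le> 1 \<Longrightarrow> f x \<le> g x"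
  shows "Aint p q f \<le> Aint p q g"
  unfolding Aint_def using assms
  by (intro integral_le Aint_integrable mult_left_mono weight_nonneg) auto

lemma Aint_const: "0 < p \<Longrightarrow> 0 < q \<Longrightarrow> Aint p q (\<lambda>_. a) = a"
  using integral_unique[OF weight_has_integral[of p q a 0]] by (simp add: Aint_def)

lemma Aint_diff:
  "continuous_on {0..1} f \<Longrightarrow> continuous_on {0..1} g \<Longrightarrow>
   Aint p q (\<lambda>x. f x - g x) = Aint p q f - Aint p q g"
  unfolding Aint_def by (simp add: right_diff_distrib integral_diff Aint_integrable)

lemma Cint_diff:
  assumes "continuous_on {0..1} f" "continuous_on {0..1} g"
  shows "Cint p q (\<lambda>x. f x - g x) = Cint p q f - Cint p q g"
proof -
  have "integral {0..1} (\<lambda>\<theta>. (2 * \<theta> - 1) * f \<theta> - (2 * \<theta> - 1) * g \<theta>) =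
     integral {0..1} (\<lambda>\<theta>. (2 * \<theta> - 1) * f \<theta>) - integral {0..1} (\<lambda>\<theta>. (2 * \<theta> - 1) * g \<theta>)"
    by (intro integral_diff integrable_continuous_real continuous_intros assms)
  then show ?thesis by (simp add: Cint_def right_diff_distrib)
qed

lemma Cint_ge:
  assumes "0 < p" "0 < q" "continuous_on {0..1} f"
    and "\<And>x y. 0 \<le> x \<Longrightarrow> x \<le> y \<Longrightarrow> y \<le> 1 \<Longrightarrow> M * (y - x) \<le> f y - f x"
  shows "p\<^sup>2 / (q * (p + q)) * (M / 6) \<le> Cint p q f"
  unfolding Cint_def using assms by (intro mult_left_mono moment_ge) auto

lemma Cint_le:
  assumes "0 < p" "0 < q" "continuous_on {0..1} f"
    and "\<And>x y. 0 \<le> x \<Longrightarrow> x \<le> y \<Longrightarrow> y \<le> 1 \<Longrightarrow> f y - f x \<le> M * (y - x)"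
  shows "Cint p q f \<le> p\<^sup>2 / (q * (p + q)) * (M / 6)"
  unfolding Cint_def using assms by (intro mult_left_mono moment_le) auto

text \<open>By the slope bound \<open>f\<close> lies below the line of slope \<open>M\<close>
  through its right end value, and the mean of a line is explicit.\<close>

lemma Aint_le_linear:
  assumes "0 < p" "0 < q" "continuous_on {0..1} f"
    and "\<And>x y. 0 \<le> x \<Longrightarrow> x \<le> y \<Longrightarrow> y \<le> 1 \<Longrightarrow> M * (y - x) \<le> f y - f x"
  shows "Aint p q f \<le> f 1 - M * (2 * p / 3 + q / 2) / (p + q)"
proof -
  have "f x \<le> f 1 - M * (1 - x)" if "0 \<le> x" "x \<le> 1" for x
    using assms(4)[of x 1] that by simp
  then have "Aint p q f \<le> Aint p q (\<lambda>x. f 1 - M * (1 - x))"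
    using assms by (intro Aint_mono continuous_intros) auto
  then show ?thesis
    using weight_has_integral[of p q "f 1" M] assms by (simp add: Aint_def integral_unique)
qed

text \<open>The only place where the step-ratio bound is used. It is sharp for the argument:
  with a common constant slope on both intervals and equality in the bound the two sides agree.\<close>

lemma moment_balance:
  assumes pos: "0 < p0" "0 < p" "0 < q" and M: "0 \<le> M"
    and mesh: "1 / ((p / p0)\<^sup>2 * (1 + p / p0)) \<le> 3 + 1 / (q / p)"
    and cont: "continuous_on {0..1} f0" "continuous_on {0..1} f"
    and le: "\<And>x y. 0 \<le> x \<Longrightarrow> x \<le> y \<Longrightarrow> y \<le> 1 \<Longrightarrow> f0 y - f0 x \<le> p0 * M * (y - x)"
    and ge: "\<And>x y. 0 \<le> x \<Longrightarrow> x \<le> y \<Longrightarrow> y \<le> 1 \<Longrightarrow> p * M * (y - x) \<le> f y - f x"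
  shows "Cint p0 p f0 + Aint p q f \<le> Cint p q f + f 1"
proof -
  have "Cint p0 p f0 \<le> p0\<^sup>2 / (p * (p0 + p)) * (p0 * M / 6)"
    using pos cont le by (intro Cint_le) auto
  also have "\<dots> = p * M / 6 * (1 / ((p / p0)\<^sup>2 * (1 + p / p0)))"
    using pos by (simp add: divide_simps power2_eq_square)
  also have "\<dots> \<le> p * M / 6 * (3 + 1 / (q / p))"
    using pos M by (intro mult_left_mono mesh) auto
  \<comment> \<open>Over the common denominator \<open>6 * q * (p + q)\<close> the right side has
    the numerator \<open>p * M\<close> times
    \<open>p^2 + 4 * p * q + 3 * q^2 = (p + q) * (p + 3 * q)\<close>. This is the origin of
    \<open>3 + 1 / (q / p)\<close> in the mesh condition.\<close>
  also have "\<dots> = p\<^sup>2 / (q * (p + q)) * (p * M / 6) + p * M * (2 * p / 3 + q / 2) / (p + q)"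
    using pos by (simp add: divide_simps power2_eq_square) algebra
  finally have "Cint p0 p f0 \<le> \<dots>" .
  moreover have "p\<^sup>2 / (q * (p + q)) * (p * M / 6) \<le> Cint p q f"
    using pos cont ge by (intro Cint_ge) auto
  moreover have "Aint p q f \<le> f 1 - p * M * (2 * p / 3 + q / 2) / (p + q)"
    using pos cont ge by (intro Aint_le_linear) auto
  ultimately show ?thesis by linarith
qed

section \<open>Convex increasing kernels\<close>

text \<open>Convexity is encoded by a monotone derivative, which supplies the comparison slope
  directly. The derivative is two-sided even at \<open>T\<close>, so a kernel must have its
  singularity strictly to the right of \<open>T\<close>.\<close>

definition convex_incr :: "real \<Rightarrow> (real \<Rightarrow> real) \<Rightarrow> bool" where
  "convex_incr T \<psi> \<longleftrightarrow> (\<exists>\<phi>. (\<forall>x\<le>T. (\<psi> has_real_derivative \<phi> x) (at x) \<and> 0 \<le> \<phi> x) \<and> mono_on {..T} \<phi>)"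

lemma convex_incr_continuous:
  assumes "convex_incr T \<psi>" shows "continuous_on {..T} \<psi>"
  using assms unfolding convex_incr_def
  by (metis DERIV_continuous continuous_at_imp_continuous_on atMost_iff)

lemma convex_incr_subset:
  assumes "convex_incr T \<psi>" "z \<le> T"
  shows "convex_incr z \<psi>"
proof -
  from assms(1) obtain \<phi> where "\<And>x. x \<le> T \<Longrightarrow> (\<psi> has_real_derivative \<phi> x) (at x) \<and> 0 \<le> \<phi> x"
    and mono: "mono_on {..T} \<phi>"
    unfolding convex_incr_def by blast
  moreover have "mono_on {..z} \<phi>" using assms(2) by (intro mono_on_subset[OF mono]) auto
  ultimately show ?thesis using assms(2) unfolding convex_incr_def by (intro exI[of _ \<phi>]) auto
qed

text \<open>\<open>M\<close> is the derivative at \<open>z\<close>; the mean value theorem and its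
  monotonicity give both bounds. One number thus serves two intervals that meet at \<open>z\<close>,
  as \<open>moment_balance\<close> requires.\<close>

lemma convex_incr_slope:
  assumes "convex_incr T \<psi>" "z \<le> T"
  obtains M where "0 \<le> M"
    "\<And>x y. x \<le> y \<Longrightarrow> y \<le> z \<Longrightarrow> \<psi> y - \<psi> x \<le> M * (y - x)"
    "\<And>x y. z \<le> x \<Longrightarrow> x \<le> y \<Longrightarrow> y \<le> T \<Longrightarrow> M * (y - x) \<le> \<psi> y - \<psi> x"
proof -
  from assms obtain \<phi> where der: "\<And>x. x \<le> T \<Longrightarrow> (\<psi> has_real_derivative \<phi> x) (at x)"
    and nn: "\<And>x. x \<le> T \<Longrightarrow> 0 \<le> \<phi> x" and mono: "mono_on {..T} \<phi>"
    unfolding convex_incr_def by blast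
  have mvt: "\<exists>w. x \<le> w \<and> w \<le> y \<and> \<psi> y - \<psi> x = \<phi> w * (y - x)" if "x \<le> y" "y \<le> T" for x y
  proof (cases "x = y")
    case False
    then have "\<exists>w>x. w < y \<and> \<psi> y - \<psi> x = (y - x) * \<phi> w"
      using that by (intro MVT2 der) auto
    then obtain w where "x < w" "w < y" "\<psi> y - \<psi> x = (y - x) * \<phi> w"
      by blast
    then show ?thesis by (intro exI[of _ w]) auto
  qed auto
  show ?thesis
  proof
    show "0 \<le> \<phi> z" using nn assms by blast
    show "\<psi> y - \<psi> x \<le> \<phi> z * (y - x)" if xy: "x \<le> y" "y \<le> z" for x y
    proof -
      obtain w where w: "x \<le> w" "w \<le> y" "\<psi> y - \<psi> x = \<phi> w * (y - x)" using mvt[of x y] xy assms by auto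
      have "\<phi> w \<le> \<phi> z" using w xy assms by (intro mono_onD[OF mono]) auto
      then show ?thesis using w xy by (simp add: mult_right_mono)
    qed
    show "\<phi> z * (y - x) \<le> \<psi> y - \<psi> x" if xy: "z \<le> x" "x \<le> y" "y \<le> T" for x y
    proof -
      obtain w where w: "x \<le> w" "w \<le> y" "\<psi> y - \<psi> x = \<phi> w * (y - x)" using mvt[of x y] xy assms by auto
      have "\<phi> z \<le> \<phi> w" using w xy assms by (intro mono_onD[OF mono]) auto
      then show ?thesis using w xy by (simp add: mult_right_mono)
    qed
  qed
qed

lemma convex_incr_mono:
  assumes "convex_incr T \<psi>" "x \<le> y" "y \<le> T"
  shows "\<psi> x \<le> \<psi> y"
proof -
  have "x \<le> T" using assms by simp
  with assms(1) obtain M where "0 \<le> M" "M * (y - x) \<le> \<psi> y - \<psi> x"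
    using assms convex_incr_slope[of T \<psi> x] by (metis order_refl)
  moreover from this assms have "0 \<le> M * (y - x)" by auto
  ultimately show ?thesis by linarith
qed

lemma power_kernel_derivative:
  fixes c :: real
  assumes "x < c"
  shows "((\<lambda>x. (c - x) powr (- b)) has_real_derivative b * (c - x) powr (- b - 1)) (at x)"
  using assms by (auto intro!: derivative_eq_intros)

lemma power_kernel_mono:
  fixes c :: real
  assumes "0 \<le> b" "x \<le> y" "y < c"
  shows "(c - x) powr (- b) \<le> (c - y) powr (- b)"
  using assms by (intro powr_mono2') auto

lemma convex_incr_power:
  assumes "0 < b" "T < c"
  shows "convex_incr T (\<lambda>x. (c - x) powr (- b))"
  unfolding convex_incr_def
proof (intro exI[of _ "\<lambda>x. b * (c - x) powr (- b - 1)"] conjI allI impI)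
  fix x assume "x \<le> T"
  then show "((\<lambda>x. (c - x) powr (- b)) has_real_derivative b * (c - x) powr (- b - 1)) (at x)"
    using assms by (intro power_kernel_derivative) auto
next
  show "mono_on {..T} (\<lambda>x. b * (c - x) powr (- b - 1))"
    using assms power_kernel_mono[of "b + 1" _ _ c] by (auto intro!: mono_onI mult_left_mono)
qed (use assms in auto)

text \<open>Differentiation only raises the exponent, and a negative power decreases in its base.
  The exponent is general because \<open>convex_incr_power_diff\<close> needs the case
  \<open>b + 1\<close>, for the derivative of the kernel difference.\<close>

lemma power_kernel_diff_mono:
  fixes c c' :: real
  assumes "0 < b" "x \<le> y" "y < c" "c \<le> c'"
  shows "(c - x) powr (- b) - (c' - x) powr (- b) \<le> (c - y) powr (- b) - (c' - y) powr (- b)"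
proof (rule DERIV_nonneg_imp_nondecreasing[OF assms(2)])
  fix z assume "x \<le> z" "z \<le> y"
  then have z: "z < c" "z < c'" using assms by auto
  show "\<exists>d. ((\<lambda>x. (c - x) powr (- b) - (c' - x) powr (- b)) has_real_derivative d) (at z) \<and> 0 \<le> d"
  proof (intro exI conjI)
    show "((\<lambda>x. (c - x) powr (- b) - (c' - x) powr (- b)) has_real_derivative
        b * (c - z) powr (- b - 1) - b * (c' - z) powr (- b - 1)) (at z)"
      using z by (intro DERIV_diff power_kernel_derivative)
    show "0 \<le> b * (c - z) powr (- b - 1) - b * (c' - z) powr (- b - 1)"
      using z assms powr_mono2'[of "- b - 1" "c - z" "c' - z"] by (simp add: mult_left_mono)
  qed
qed

lemma convex_incr_power_diff:
  assumes "0 < b" "T < c" "c \<le> c'"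
  shows "convex_incr T (\<lambda>x. (c - x) powr (- b) - (c' - x) powr (- b))"
  unfolding convex_incr_def
proof (intro exI[of _ "\<lambda>x. b * (c - x) powr (- b - 1) - b * (c' - x) powr (- b - 1)"] conjI allI impI)
  fix x assume x: "x \<le> T"
  show "((\<lambda>x. (c - x) powr (- b) - (c' - x) powr (- b)) has_real_derivative
      b * (c - x) powr (- b - 1) - b * (c' - x) powr (- b - 1)) (at x)"
    using assms x by (intro DERIV_diff power_kernel_derivative) auto
  show "0 \<le> b * (c - x) powr (- b - 1) - b * (c' - x) powr (- b - 1)"
    using x assms powr_mono2'[of "- b - 1" "c - x" "c' - x"] by (simp add: mult_left_mono)
next
  show "mono_on {..T} (\<lambda>x. b * (c - x) powr (- b - 1) - b * (c' - x) powr (- b - 1))"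
    using assms power_kernel_diff_mono[of "b + 1" _ _ c c']
    by (auto intro!: mono_onI simp: right_diff_distrib[symmetric])
qed

section \<open>The kernels on a mesh\<close>

text \<open>With \<open>s = 1 - \<theta>\<close> the factor \<open>2 * s + \<rho>\<close> is the
  derivative of \<open>s * (s + \<rho>)\<close>. Integration by parts has no boundary term at
  \<open>s = 0\<close>, the one at \<open>s = 1\<close> is the first summand, and the remainder is
  bounded by the second.\<close>

lemma weighted_kernel_integral_le:
  fixes \<rho> \<sigma> \<alpha> :: real
  assumes pos: "0 < \<rho>" "0 < \<sigma>" "0 < \<alpha>"
  shows "integral {0..1} (\<lambda>\<theta>. (2 * (1 - \<theta>) + \<rho>) * (\<sigma> * \<rho> + (1 - \<theta>)) powr (- \<alpha>))
     \<le> (1 + \<rho>) * (\<sigma> * \<rho> + 1) powr (- \<alpha>)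
       + \<alpha> * (\<sigma> * \<rho>) powr (- \<alpha>) * integral {0..1} (\<lambda>s. s * (\<rho> + s) / (\<sigma> * \<rho> + s))"
proof -
  define h where "h s = s * (\<rho> + s) / (\<sigma> * \<rho> + s)" for s
  define G where "G \<theta> = - (1 - \<theta>) * ((1 - \<theta>) + \<rho>) * (\<sigma> * \<rho> + (1 - \<theta>)) powr (- \<alpha>)" for \<theta>
  define g where "g \<theta> = (2 * (1 - \<theta>) + \<rho>) * (\<sigma> * \<rho> + (1 - \<theta>)) powr (- \<alpha>)
      - \<alpha> * (1 - \<theta>) * ((1 - \<theta>) + \<rho>) * (\<sigma> * \<rho> + (1 - \<theta>)) powr (- \<alpha> - 1)" for \<theta>
  have sr: "0 < \<sigma> * \<rho>" using pos by simp
  have G: "(g has_integral G 1 - G 0) {0..1}"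
  proof (rule fundamental_theorem_of_calculus)
    fix x :: real assume "x \<in> {0..1}"
    then have x: "0 < \<sigma> * \<rho> + (1 - x)" using sr by simp
    have K: "((\<lambda>\<theta>. (\<sigma> * \<rho> + (1 - \<theta>)) powr (- \<alpha>)) has_real_derivative
          \<alpha> * (\<sigma> * \<rho> + (1 - x)) powr (- \<alpha> - 1)) (at x)"
      using power_kernel_derivative[of x "\<sigma> * \<rho> + 1" \<alpha>] x by (simp add: algebra_simps)
    have "(G has_real_derivative g x) (at x)"
      unfolding G_def g_def
      by (rule derivative_eq_intros K refl)+ (simp add: algebra_simps)
    then show "(G has_vector_derivative g x) (at x within {0..1})"
      by (simp add: has_real_derivative_iff_has_vector_derivative[symmetric] has_field_derivative_at_within)
  qed simp
  have "h integrable_on {0..1}"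
    unfolding h_def using sr by (intro integrable_continuous_real continuous_intros) auto
  then have "(h has_integral integral {0..1} h) (cbox 0 1)" by (simp add: has_integral_integral)
  \<comment> \<open>The reflection \<open>s = 1 - \<theta>\<close> moves the rational integral to
    the variable of the left side.\<close>
  from has_integral_affinity[OF this, of "- 1" 1]
  have h: "((\<lambda>\<theta>. h (1 - \<theta>)) has_integral integral {0..1} h) {0..1}"
    by simp
  have "integral {0..1} (\<lambda>\<theta>. (2 * (1 - \<theta>) + \<rho>) * (\<sigma> * \<rho> + (1 - \<theta>)) powr (- \<alpha>))
     \<le> G 1 - G 0 + \<alpha> * (\<sigma> * \<rho>) powr (- \<alpha>) * integral {0..1} h"
  proof (rule has_integral_le[OF integrable_integral has_integral_add[OF G has_integral_mult_right[OF h]]])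
    show "(\<lambda>\<theta>. (2 * (1 - \<theta>) + \<rho>) * (\<sigma> * \<rho> + (1 - \<theta>)) powr (- \<alpha>)) integrable_on {0..1}"
      using sr by (intro integrable_continuous_real continuous_intros) auto
    fix x :: real assume x: "x \<in> {0..1}"
    define s where "s = 1 - x"
    have s: "0 \<le> s" using x by (simp add: s_def)
    have "(\<sigma> * \<rho> + s) powr (- \<alpha> - 1) = (\<sigma> * \<rho> + s) powr (- \<alpha>) / (\<sigma> * \<rho> + s)"
      using sr s by (simp add: powr_diff)
    also have "\<dots> \<le> (\<sigma> * \<rho>) powr (- \<alpha>) / (\<sigma> * \<rho> + s)"
      using sr s pos by (intro divide_right_mono powr_mono2') auto
    finally have "\<alpha> * s * (s + \<rho>) * (\<sigma> * \<rho> + s) powr (- \<alpha> - 1)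
        \<le> \<alpha> * s * (s + \<rho>) * ((\<sigma> * \<rho>) powr (- \<alpha>) / (\<sigma> * \<rho> + s))"
      using s pos by (intro mult_left_mono) auto
    also have "\<dots> = \<alpha> * (\<sigma> * \<rho>) powr (- \<alpha>) * h s" by (simp add: h_def algebra_simps)
    finally show "(2 * (1 - x) + \<rho>) * (\<sigma> * \<rho> + (1 - x)) powr (- \<alpha>)
       \<le> g x + \<alpha> * (\<sigma> * \<rho>) powr (- \<alpha>) * h (1 - x)"
      by (simp add: g_def s_def)
  qed
  moreover have "G 1 - G 0 = (1 + \<rho>) * (\<sigma> * \<rho> + 1) powr (- \<alpha>)"
    by (simp add: G_def algebra_simps)
  ultimately show ?thesis by (simp add: h_def[abs_def])
qed

text \<open>For \<open>\<sigma> > 1/2\<close> one has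
  \<open>\<rho> + s \<le> 2 * (\<sigma> * \<rho> + s)\<close>, so the integrand stays below
  \<open>2 * s\<close>.\<close>

lemma rational_integral_bounds:
  fixes \<rho> \<sigma> :: real
  assumes "0 < \<rho>" "1/2 < \<sigma>"
  shows "0 \<le> integral {0..1} (\<lambda>s. s * (\<rho> + s) / (\<sigma> * \<rho> + s))"
    and "integral {0..1} (\<lambda>s. s * (\<rho> + s) / (\<sigma> * \<rho> + s)) \<le> 1"
proof -
  have sr: "0 < \<sigma> * \<rho>" using assms by simp
  have int: "(\<lambda>s. s * (\<rho> + s) / (\<sigma> * \<rho> + s)) integrable_on {0..1}"
    using sr by (intro integrable_continuous_real continuous_intros) auto
  show "0 \<le> integral {0..1} (\<lambda>s. s * (\<rho> + s) / (\<sigma> * \<rho> + s))"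
    using assms sr by (intro integral_nonneg int) auto
  have "((\<lambda>s. 2 * s) has_integral 1\<^sup>2 - 0\<^sup>2) {0..1::real}"
  proof (rule fundamental_theorem_of_calculus)
    show "((\<lambda>s. s\<^sup>2) has_vector_derivative 2 * x) (at x within {0..1})" for x :: real
      unfolding has_real_derivative_iff_has_vector_derivative[symmetric]
      by (auto intro!: derivative_eq_intros)
  qed simp
  then have "((\<lambda>s. 2 * s) has_integral (1::real)) {0..1}" by simp
  then show "integral {0..1} (\<lambda>s. s * (\<rho> + s) / (\<sigma> * \<rho> + s)) \<le> 1"
  proof (rule has_integral_le[OF integrable_integral[OF int]])
    fix s :: real assume s: "s \<in> {0..1}"
    have "1 * \<rho> \<le> 2 * \<sigma> * \<rho>" using assms by (intro mult_right_mono) auto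
    then have "s * (\<rho> + s) \<le> s * (2 * (\<sigma> * \<rho> + s))" using s by (intro mult_left_mono) auto
    then show "s * (\<rho> + s) / (\<sigma> * \<rho> + s) \<le> 2 * s"
      using s sr by (simp add: pos_divide_le_eq algebra_simps)
  qed
qed

text \<open>The two branches of the mesh hypothesis are condensed into \<open>ratio_bound\<close>,
  which has no denominator that changes sign at \<open>eta\<close>; of \<open>rho_star\<close> only
  the bound \<open>1/3\<close> is kept.\<close>

locale frac_mesh =
  fixes \<alpha> :: real and t :: "nat \<Rightarrow> real"
  assumes alpha: "0 < \<alpha>" "\<alpha> < 1"
    and tmono: "strict_mono t"
    and ratio_gt: "\<And>k. 2 \<le> k \<Longrightarrow> 1/3 < ratio t k"
    and ratio_bound: "\<And>k. 2 \<le> k \<Longrightarrow>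
      1 / ((ratio t k)\<^sup>2 * (1 + ratio t k)) \<le> 3 + 1 / ratio t (k + 1)"
begin

abbreviation "\<sigma> \<equiv> sigma \<alpha>"

definition kern :: "nat \<Rightarrow> real \<Rightarrow> real" where
  "kern k x = (tstar \<alpha> t k - x) powr (- \<alpha>)"

definition piece :: "nat \<Rightarrow> (real \<Rightarrow> real) \<Rightarrow> real \<Rightarrow> real" where
  "piece j \<psi> \<theta> = \<psi> (t (j - 1) + \<theta> * tau t j)"

text \<open>The scheme coefficients as linear functionals of a kernel: at \<open>kern k\<close> they
  become \<open>- acoef\<close> and \<open>ccoef\<close>. The same inequalities can then be applied
  to differences of kernels.\<close>

definition A :: "nat \<Rightarrow> (real \<Rightarrow> real) \<Rightarrow> real" where
  "A j \<psi> = Aint (tau t j) (tau t (Suc j)) (piece j \<psi>)"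

text \<open>The value at \<open>j = 0\<close> mirrors the default of \<open>ccoef\<close>, so that
  the first column also has the form \<open>C (j - 1) + A j\<close>.\<close>

definition C :: "nat \<Rightarrow> (real \<Rightarrow> real) \<Rightarrow> real" where
  "C j \<psi> = (if j = 0 then 0 else Cint (tau t j) (tau t (Suc j)) (piece j \<psi>))"

section \<open>Elementary facts on the mesh\<close>

lemma tau_pos: "1 \<le> j \<Longrightarrow> 0 < tau t j"
  using tmono by (simp add: tau_def strict_mono_less)

lemma t_mono: "i \<le> j \<Longrightarrow> t i \<le> t j"
  using tmono by (simp add: strict_mono_less_eq)

lemma sigma_bounds: "1/2 < \<sigma>" "\<sigma> < 1"
  using alpha by (auto simp: sigma_def)

lemma ratio_pos: "2 \<le> k \<Longrightarrow> 0 < ratio t k"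
  using ratio_gt[of k] by simp

lemma t_less_tstar:
  assumes "j < k" shows "t j < tstar \<alpha> t k"
proof -
  have "t j \<le> t (k - 1)" using assms by (intro t_mono) auto
  also have "\<dots> < tstar \<alpha> t k" using assms tau_pos[of k] sigma_bounds by (simp add: tstar_def)
  finally show ?thesis .
qed

text \<open>Since \<open>\<sigma> < 1\<close>, the node \<open>t k\<close> separates the two
  points.\<close>

lemma tstar_le_Suc: "1 \<le> k \<Longrightarrow> tstar \<alpha> t k \<le> tstar \<alpha> t (Suc k)"
proof -
  assume k: "1 \<le> k"
  have "\<sigma> * tau t k \<le> 1 * tau t k"
    using sigma_bounds tau_pos[OF k] by (intro mult_right_mono) auto
  then have "tstar \<alpha> t k \<le> t k" by (simp add: tstar_def) (simp add: tau_def)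
  with t_less_tstar[of k "Suc k"] show ?thesis by simp
qed

lemma convex_incr_kern: "j < k \<Longrightarrow> convex_incr (t j) (kern k)"
  unfolding kern_def[abs_def] using alpha
  by (intro convex_incr_power t_less_tstar) auto

lemma convex_incr_kern_diff:
  "j < k \<Longrightarrow> convex_incr (t j) (\<lambda>x. kern k x - kern (Suc k) x)"
  unfolding kern_def using alpha
  by (intro convex_incr_power_diff tstar_le_Suc t_less_tstar) auto

lemma node_bounds:
  assumes "1 \<le> j" "0 \<le> \<theta>" "\<theta> \<le> 1"
  shows "t (j - 1) \<le> t (j - 1) + \<theta> * tau t j" "t (j - 1) + \<theta> * tau t j \<le> t j"
proof -
  have "\<theta> * tau t j \<le> 1 * tau t j" using assms tau_pos[of j] by (intro mult_right_mono) auto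
  then show "t (j - 1) + \<theta> * tau t j \<le> t j" by (simp add: tau_def)
  show "t (j - 1) \<le> t (j - 1) + \<theta> * tau t j" using assms tau_pos[of j] by simp
qed

section \<open>Inequalities for increasing convex kernels\<close>

lemma piece_1: "piece j \<psi> 1 = \<psi> (t j)"
  by (simp add: piece_def tau_def)

lemma piece_continuous:
  assumes "convex_incr (t j) \<psi>" "1 \<le> j"
  shows "continuous_on {0..1} (piece j \<psi>)"
proof -
  have "continuous_on {0..1} (\<psi> \<circ> (\<lambda>\<theta>. t (j - 1) + \<theta> * tau t j))"
    using node_bounds(2)[OF assms(2)]
    by (intro continuous_on_compose continuous_intros continuous_on_subset[OF convex_incr_continuous[OF assms(1)]]) auto
  then show ?thesis by (simp add: piece_def[abs_def] o_def)
qed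

text \<open>\<open>A j\<close> is a mean over the \<open>j\<close>-th interval, hence at least the
  left end value of an increasing function; \<open>A_le\<close> is the counterpart at the right
  end.\<close>

lemma A_ge:
  assumes "convex_incr (t j) \<psi>" "1 \<le> j"
  shows "\<psi> (t (j - 1)) \<le> A j \<psi>"
proof -
  have "Aint (tau t j) (tau t (Suc j)) (\<lambda>_. \<psi> (t (j - 1))) \<le> A j \<psi>"
    unfolding A_def using assms tau_pos
    by (intro Aint_mono piece_continuous continuous_intros)
      (auto simp: piece_def intro!: convex_incr_mono[OF assms(1)] node_bounds[simplified])
  then show ?thesis using assms tau_pos by (simp add: Aint_const)
qed

lemma A_le:
  assumes "convex_incr (t j) \<psi>" "1 \<le> j"
  shows "A j \<psi> \<le> \<psi> (t j)"
proof -
  have "A j \<psi> \<le> Aint (tau t j) (tau t (Suc j)) (\<lambda>_. \<psi> (t j))"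
    unfolding A_def using assms tau_pos
    by (intro Aint_mono piece_continuous continuous_intros)
      (auto simp: piece_def intro!: convex_incr_mono[OF assms(1)] node_bounds[simplified])
  then show ?thesis using assms tau_pos by (simp add: Aint_const)
qed

lemma C_nonneg:
  assumes "convex_incr (t j) \<psi>"
  shows "0 \<le> C j \<psi>"
proof (cases "j = 0")
  case False
  then have j: "1 \<le> j" by simp
  have "(tau t j)\<^sup>2 / (tau t (Suc j) * (tau t j + tau t (Suc j))) * (0 / 6)
      \<le> Cint (tau t j) (tau t (Suc j)) (piece j \<psi>)"
  proof (intro Cint_ge piece_continuous assms j tau_pos)
    fix x y :: real assume xy: "0 \<le> x" "x \<le> y" "y \<le> 1"
    then have "piece j \<psi> x \<le> piece j \<psi> y"
      unfolding piece_def using j tau_pos[OF j]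
      by (intro convex_incr_mono[OF assms]) (auto intro!: node_bounds[simplified] mult_right_mono)
    then show "0 * (y - x) \<le> piece j \<psi> y - piece j \<psi> x" by simp
  qed simp
  then show ?thesis using False by (simp add: C_def)
qed (simp add: C_def)

text \<open>This is the central functional inequality, with indices such that the tangent slope is
  taken at \<open>t (j - 1)\<close>, the node shared by intervals \<open>j - 1\<close> and
  \<open>j\<close>. Rescaling to the unit interval multiplies that slope by the step. For
  \<open>j = 1\<close> there is no previous interval, and \<open>A_le\<close> with
  \<open>C_nonneg\<close> suffices.\<close>

lemma coefficient_balance:
  assumes \<psi>: "convex_incr (t j) \<psi>" and j: "1 \<le> j"
  shows "C (j - 1) \<psi> + A j \<psi> \<le> C j \<psi> + \<psi> (t j)"
proof (cases "j = 1")
  case True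
  then show ?thesis using A_le[OF \<psi> j] C_nonneg[OF \<psi>] by (simp add: C_def)
next
  case False
  then have j2: "2 \<le> j" using j by simp
  obtain M where M: "0 \<le> M"
    "\<And>x y. x \<le> y \<Longrightarrow> y \<le> t (j - 1) \<Longrightarrow> \<psi> y - \<psi> x \<le> M * (y - x)"
    "\<And>x y. t (j - 1) \<le> x \<Longrightarrow> x \<le> y \<Longrightarrow> y \<le> t j \<Longrightarrow> M * (y - x) \<le> \<psi> y - \<psi> x"
    using convex_incr_slope[OF \<psi>, of "t (j - 1)"] t_mono[of "j - 1" j] by auto
  have \<psi>': "convex_incr (t (j - 1)) \<psi>"
    using \<psi> t_mono[of "j - 1" j] by (auto intro: convex_incr_subset)
  have pos: "0 < tau t (j - 1)" "0 < tau t j" "0 < tau t (Suc j)"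
    using j2 by (auto intro: tau_pos)
  have "Cint (tau t (j - 1)) (tau t j) (piece (j - 1) \<psi>) + Aint (tau t j) (tau t (Suc j)) (piece j \<psi>)
      \<le> Cint (tau t j) (tau t (Suc j)) (piece j \<psi>) + piece j \<psi> 1"
  proof (rule moment_balance[OF pos M(1)])
    show "1 / ((tau t j / tau t (j - 1))\<^sup>2 * (1 + tau t j / tau t (j - 1))) \<le> 3 + 1 / (tau t (Suc j) / tau t j)"
      using ratio_bound[OF j2] by (simp add: ratio_def)
    show "continuous_on {0..1} (piece (j - 1) \<psi>)" "continuous_on {0..1} (piece j \<psi>)"
      using j2 \<psi> \<psi>' by (auto intro: piece_continuous)
    fix x y :: real assume xy: "0 \<le> x" "x \<le> y" "y \<le> 1"
    show "piece (j - 1) \<psi> y - piece (j - 1) \<psi> x \<le> tau t (j - 1) * M * (y - x)"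
      unfolding piece_def
      using M(2)[of "t (j - 1 - 1) + x * tau t (j - 1)" "t (j - 1 - 1) + y * tau t (j - 1)"]
        node_bounds(2)[of "j - 1" y] j2 xy pos
      by (simp add: mult_right_mono algebra_simps)
    show "tau t j * M * (y - x) \<le> piece j \<psi> y - piece j \<psi> x"
      unfolding piece_def
      using M(3)[of "t (j - 1) + x * tau t j" "t (j - 1) + y * tau t j"]
        node_bounds(1)[of j x] node_bounds(2)[of j y] j xy pos
      by (simp add: mult_right_mono algebra_simps)
  qed
  then show ?thesis using j2 by (simp add: A_def C_def piece_1)
qed

lemma A_kern_diff:
  assumes "1 \<le> j" "j < k"
  shows "A j (\<lambda>x. kern k x - kern (Suc k) x) = A j (kern k) - A j (kern (Suc k))"
  using Aint_diff[OF piece_continuous[OF convex_incr_kern[of j k]] piece_continuous[OF convex_incr_kern[of j "Suc k"]]] assms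
  by (simp add: A_def piece_def[abs_def])

lemma C_kern_diff:
  assumes "j < k"
  shows "C j (\<lambda>x. kern k x - kern (Suc k) x) = C j (kern k) - C j (kern (Suc k))"
  using Cint_diff[OF piece_continuous[OF convex_incr_kern[of j k]] piece_continuous[OF convex_incr_kern[of j "Suc k"]]] assms
  by (simp add: C_def piece_def[abs_def])

section \<open>Identification of the scheme coefficients and kernel values\<close>

lemma acoef_eq:
  assumes "1 \<le> j" "j < k"
  shows "acoef \<alpha> t k j = - A j (kern k)"
proof -
  have "(- 2 * tau t j * (1 - \<theta>) - tau t (j + 1)) /
        ((tau t j + tau t (j + 1)) * (tstar \<alpha> t k - t (j - 1) - \<theta> * tau t j) powr \<alpha>)
      = - (weight (tau t j) (tau t (Suc j)) \<theta> * piece j (kern k) \<theta>)" for \<theta>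
    by (simp add: weight_def piece_def kern_def powr_minus_divide algebra_simps
        diff_divide_distrib add_divide_distrib)
  then show ?thesis using assms by (simp add: acoef_def A_def Aint_def)
qed

lemma ccoef_eq:
  assumes "j < k"
  shows "ccoef \<alpha> t k j = C j (kern k)"
proof (cases "j = 0")
  case False
  have "(tau t j)\<^sup>2 * (2 * \<theta> - 1) /
        (tau t (j + 1) * (tau t j + tau t (j + 1)) * (tstar \<alpha> t k - t (j - 1) - \<theta> * tau t j) powr \<alpha>)
      = (tau t j)\<^sup>2 / (tau t (Suc j) * (tau t j + tau t (Suc j))) * ((2 * \<theta> - 1) * piece j (kern k) \<theta>)" for \<theta>
    by (simp add: piece_def kern_def powr_minus_divide diff_diff_eq)
  with False assms show ?thesis by (simp add: ccoef_def C_def Cint_def)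
qed (simp add: ccoef_def C_def)

lemma dcoef_eq:
  assumes "1 \<le> j" "j < k"
  shows "dcoef \<alpha> t k j = C (j - 1) (kern k) + A j (kern k)"
  using assms by (simp add: dcoef_def acoef_eq ccoef_eq)

lemma kern_node: "1 \<le> k \<Longrightarrow> kern k (t (k - 1)) = 1 / (\<sigma> * tau t k) powr \<alpha>"
  by (simp add: kern_def tstar_def powr_minus_divide)

lemma A_next:
  assumes k: "1 \<le> k"
  defines "\<rho> \<equiv> ratio t (k + 1)"
  shows "A k (kern (Suc k)) \<le> kern (Suc k) (t (k - 1))
     + kern (Suc k) (t k) * (\<alpha> / (1 + \<rho>)) * integral {0..1} (\<lambda>s. s * (\<rho> + s) / (\<sigma> * \<rho> + s))"
proof -
  define p where "p = tau t k"
  have p: "0 < p" using tau_pos k by (simp add: p_def)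
  have r: "0 < \<rho>" using ratio_pos k by (simp add: \<rho>_def)
  have q: "tau t (Suc k) = \<rho> * p" using p by (simp add: \<rho>_def ratio_def p_def)
  have kern: "kern (Suc k) (t k - p * s) = p powr (- \<alpha>) * (\<sigma> * \<rho> + s) powr (- \<alpha>)"
    if "0 \<le> s" for s
  proof -
    have "kern (Suc k) (t k - p * s) = (p * (\<sigma> * \<rho> + s)) powr (- \<alpha>)"
      by (simp add: kern_def tstar_def q algebra_simps)
    then show ?thesis using p r sigma_bounds that by (simp add: powr_mult)
  qed
  have node: "t (k - 1) = t k - p * 1" by (simp add: p_def tau_def)
  have A: "A k (kern (Suc k)) = p powr (- \<alpha>) / (1 + \<rho>) *
      integral {0..1} (\<lambda>\<theta>. (2 * (1 - \<theta>) + \<rho>) * (\<sigma> * \<rho> + (1 - \<theta>)) powr (- \<alpha>))"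
  proof -
    have "A k (kern (Suc k)) = integral {0..1} (\<lambda>\<theta>. p powr (- \<alpha>) / (1 + \<rho>) *
        ((2 * (1 - \<theta>) + \<rho>) * (\<sigma> * \<rho> + (1 - \<theta>)) powr (- \<alpha>)))"
      unfolding A_def Aint_def
    proof (rule integral_cong)
      fix \<theta> :: real assume \<theta>: "\<theta> \<in> {0..1}"
      have "weight (tau t k) (tau t (Suc k)) \<theta> = (p * (2 * (1 - \<theta>) + \<rho>)) / (p * (1 + \<rho>))"
        by (simp add: weight_def q p_def[symmetric] algebra_simps)
      also have "\<dots> = (2 * (1 - \<theta>) + \<rho>) / (1 + \<rho>)" using p by simp
      finally have w: "weight (tau t k) (tau t (Suc k)) \<theta> = (2 * (1 - \<theta>) + \<rho>) / (1 + \<rho>)" .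
      have arg: "t (k - 1) + \<theta> * tau t k = t k - p * (1 - \<theta>)"
        by (simp add: p_def tau_def algebra_simps)
      have "piece k (kern (Suc k)) \<theta> = kern (Suc k) (t k - p * (1 - \<theta>))"
        by (simp only: piece_def arg)
      with w \<theta> show "weight (tau t k) (tau t (Suc k)) \<theta> * piece k (kern (Suc k)) \<theta> =
          p powr (- \<alpha>) / (1 + \<rho>) * ((2 * (1 - \<theta>) + \<rho>) * (\<sigma> * \<rho> + (1 - \<theta>)) powr (- \<alpha>))"
        by (simp add: kern)
    qed
    then show ?thesis by simp
  qed
  also have "\<dots> \<le> p powr (- \<alpha>) / (1 + \<rho>) * ((1 + \<rho>) * (\<sigma> * \<rho> + 1) powr (- \<alpha>)
       + \<alpha> * (\<sigma> * \<rho>) powr (- \<alpha>) * integral {0..1} (\<lambda>s. s * (\<rho> + s) / (\<sigma> * \<rho> + s)))"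
    using r alpha sigma_bounds by (intro mult_left_mono weighted_kernel_integral_le) auto
  also have "\<dots> = p powr (- \<alpha>) * (\<sigma> * \<rho> + 1) powr (- \<alpha>)
     + p powr (- \<alpha>) * (\<sigma> * \<rho>) powr (- \<alpha>) * (\<alpha> / (1 + \<rho>)) *
       integral {0..1} (\<lambda>s. s * (\<rho> + s) / (\<sigma> * \<rho> + s))"
    using r by (simp add: distrib_left)
  also have "p powr (- \<alpha>) * (\<sigma> * \<rho> + 1) powr (- \<alpha>) = kern (Suc k) (t (k - 1))"
    using kern[of 1] node by simp
  also have "p powr (- \<alpha>) * (\<sigma> * \<rho>) powr (- \<alpha>) = kern (Suc k) (t k)"
    using kern[of 0] by simp
  finally show ?thesis .
qed

text \<open>Turns the powers of the ratio in \<open>gcoef\<close> into a kernel value of the next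
  row.\<close>

lemma kern_node_ratio:
  assumes "1 \<le> k"
  shows "kern k (t (k - 1)) / ratio t (k + 1) powr \<alpha> = kern (Suc k) (t k)"
proof -
  have "\<sigma> * tau t (Suc k) = \<sigma> * tau t k * ratio t (k + 1)"
    using tau_pos[OF assms] by (simp add: ratio_def)
  then have "(\<sigma> * tau t (Suc k)) powr \<alpha> = (\<sigma> * tau t k) powr \<alpha> * ratio t (k + 1) powr \<alpha>"
    using tau_pos[OF assms] sigma_bounds ratio_pos[of "k + 1"] assms by (simp add: powr_mult)
  then show ?thesis using kern_node[OF assms] kern_node[of "Suc k"] by simp
qed

section \<open>Positivity of the lower bound\<close>

lemma gcoef_pos:
  assumes k: "1 \<le> k"
  shows "0 < gcoef \<alpha> t n k"
proof -
  define \<rho> where "\<rho> = ratio t (k + 1)"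
  have r: "1/3 < \<rho>" using ratio_gt k by (simp add: \<rho>_def)
  have X: "0 < 1 / (\<sigma> * tau t k) powr \<alpha>" using tau_pos[OF k] sigma_bounds by simp
  have c: "0 \<le> (1 - \<alpha>) * ccoef \<alpha> t k (k - 1)"
    using alpha k C_nonneg[OF convex_incr_kern[of "k - 1" k]] by (simp add: ccoef_eq)
  have ra: "(1/3) powr \<alpha> \<le> \<rho> powr \<alpha>" using r alpha by (intro powr_mono2) auto
  consider "k = 1" | "k \<noteq> 1" "k = n" | "k \<noteq> 1" "k \<noteq> n" by blast
  then show ?thesis
  proof cases
    case 1
    \<comment> \<open>Young's inequality, weights \<open>\<alpha>\<close> and
      \<open>1 - \<alpha>\<close>. The gap between \<open>2 - \<alpha>\<close> and
      \<open>(1 - \<alpha>) * (1 + 2 * \<alpha>)\<close> is the sum of squares in the next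
      line.\<close>
    have "3 powr \<alpha> \<le> 1 + 2 * \<alpha>"
      using Youngs_inequality_0[of \<alpha> "1 - \<alpha>" 3 1] alpha by simp
    moreover have "0 < (1 - \<alpha>)\<^sup>2 + \<alpha>\<^sup>2" using alpha by (simp add: add_pos_pos)
    ultimately have "(1 - \<alpha>) * 3 powr \<alpha> < 2 - \<alpha>"
      using alpha mult_left_mono[of "3 powr \<alpha>" "1 + 2 * \<alpha>" "1 - \<alpha>"]
      by (simp add: power2_eq_square algebra_simps)
    moreover have "(1 - \<alpha>) / \<rho> powr \<alpha> \<le> (1 - \<alpha>) / (1/3) powr \<alpha>"
      using ra alpha r by (intro divide_left_mono) auto
    moreover have "(1/3::real) powr \<alpha> = 1 / 3 powr \<alpha>" by (simp add: powr_divide)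
    ultimately have "0 < 2 * \<sigma> - (1 - \<alpha>) / \<rho> powr \<alpha>" by (simp add: sigma_def)
    with X 1 show ?thesis by (simp add: gcoef_def \<rho>_def numeral_2_eq_2)
  next
    case 2
    then show ?thesis using add_nonneg_pos[OF c X] by (simp add: gcoef_def)
  next
    case 3
    define I where "I = integral {0..1} (\<lambda>s. s * (\<rho> + s) / (\<sigma> * \<rho> + s))"
    have I: "0 \<le> I" "I \<le> 1" using rational_integral_bounds r sigma_bounds by (auto simp: I_def)
    have "(1/3) powr 1 \<le> (1/3::real) powr \<alpha>" using alpha by (intro powr_mono') auto
    then have "1/3 \<le> \<rho> powr \<alpha>" using ra by simp
    \<comment> \<open>The denominator is at least \<open>4/9\<close>, while
      \<open>\<alpha> * (1 - \<alpha>)\<close> is at most \<open>1/4\<close>.\<close>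
    then have "4/3 * (1/3) \<le> (1 + \<rho>) * \<rho> powr \<alpha>" using r by (intro mult_mono) auto
    moreover have "\<alpha> * (1 - \<alpha>) \<le> 1/4"
      using zero_le_power2[of "\<alpha> - 1/2"] by (simp add: power2_eq_square algebra_simps)
    ultimately have "\<alpha> * (1 - \<alpha>) / ((1 + \<rho>) * \<rho> powr \<alpha>) < 1"
      by (subst pos_divide_less_eq) auto
    moreover have "0 \<le> \<alpha> * (1 - \<alpha>) / ((1 + \<rho>) * \<rho> powr \<alpha>)" using alpha r by simp
    ultimately have "\<alpha> * (1 - \<alpha>) / ((1 + \<rho>) * \<rho> powr \<alpha>) * I < 1"
      using I mult_left_le[of I "\<alpha> * (1 - \<alpha>) / ((1 + \<rho>) * \<rho> powr \<alpha>)"] by linarith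
    then have "0 < (1 / (\<sigma> * tau t k) powr \<alpha>) * (1 - \<alpha> * (1 - \<alpha>) / ((1 + \<rho>) * \<rho> powr \<alpha>) * I)"
      using X by (intro mult_pos_pos) auto
    with 3 c show ?thesis by (simp add: gcoef_def I_def \<rho>_def)
  qed
qed

section \<open>The comparison matrix and its two monotonicity conditions\<close>

text \<open>The diagonal carries the factor 2 and absorbs the lower bound $g_k$; only $j \le k$ is meaningful.\<close>

definition S :: "nat \<Rightarrow> nat \<Rightarrow> nat \<Rightarrow> real" where
  "S n k j = (if j = 0 then 0 else if j < k then dcoef \<alpha> t k j
     else 2 * (ccoef \<alpha> t k (k - 1) + \<sigma> / (1 - \<alpha>) * kern k (t (k - 1))) - gcoef \<alpha> t n k / (1 - \<alpha>))"

lemma S_below: "1 \<le> j \<Longrightarrow> j < k \<Longrightarrow> S n k j = C (j - 1) (kern k) + A j (kern k)"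
  by (simp add: S_def dcoef_eq)

text \<open>Here the choice of \<open>\<sigma>\<close> enters: as
  \<open>2 * \<sigma> - 1 = 1 - \<alpha>\<close>, exactly one copy of the kernel value survives on
  the diagonal.\<close>

lemma sigma_cancel: "2 * (\<sigma> / (1 - \<alpha>) * K) - K / (1 - \<alpha>) = K"
proof -
  have "2 * (\<sigma> / (1 - \<alpha>) * K) - K / (1 - \<alpha>) = (2 * \<sigma> - 1) * K / (1 - \<alpha>)"
    by (simp add: left_diff_distrib diff_divide_distrib)
  also have "2 * \<sigma> - 1 = 1 - \<alpha>" by (simp add: sigma_def)
  finally show ?thesis using alpha by simp
qed

text \<open>The first \<open>gcoef\<close> cancels the local term completely and leaves the value
  that bounds \<open>A 1 (kern 2)\<close> from above.\<close>

lemma S_diag_1: "S n 1 1 = kern 2 (t 1)"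
proof -
  have "gcoef \<alpha> t n 1 = 2 * \<sigma> * kern 1 (t 0) - (1 - \<alpha>) * (kern 1 (t 0) / ratio t 2 powr \<alpha>)"
    using kern_node[of 1] by (simp add: gcoef_def algebra_simps)
  also have "kern 1 (t 0) / ratio t 2 powr \<alpha> = kern 2 (t 1)"
    using kern_node_ratio[of 1] by (simp add: numeral_2_eq_2)
  finally show ?thesis
    using alpha by (simp add: S_def ccoef_def diff_divide_distrib)
qed

text \<open>What remains after \<open>gcoef\<close> is subtracted is the right side of
  \<open>coefficient_balance\<close> at \<open>j = n - 1\<close>.\<close>

lemma S_diag_last:
  assumes "2 \<le> n"
  shows "S n n n = C (n - 1) (kern n) + kern n (t (n - 1))"
proof -
  have g: "gcoef \<alpha> t n n = (1 - \<alpha>) * C (n - 1) (kern n) + kern n (t (n - 1))"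
    using assms kern_node[of n] by (simp add: gcoef_def ccoef_eq)
  show ?thesis
    using alpha assms sigma_cancel[of "kern n (t (n - 1))"]
    by (simp add: S_def g ccoef_eq add_divide_distrib)
qed

text \<open>Compared with the last row, the diagonal keeps an extra term, equal to the remainder in
  \<open>A_next\<close>.\<close>

lemma S_diag_mid:
  assumes "2 \<le> k" "k < n"
  defines "\<rho> \<equiv> ratio t (k + 1)"
  shows "S n k k = C (k - 1) (kern k) + kern k (t (k - 1))
     + kern (Suc k) (t k) * (\<alpha> / (1 + \<rho>)) * integral {0..1} (\<lambda>s. s * (\<rho> + s) / (\<sigma> * \<rho> + s))"
proof -
  define I where "I = integral {0..1} (\<lambda>s. s * (\<rho> + s) / (\<sigma> * \<rho> + s))"
  have "gcoef \<alpha> t n k = (1 - \<alpha>) * C (k - 1) (kern k) + kern k (t (k - 1)) *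
      (1 - \<alpha> * (1 - \<alpha>) / ((1 + \<rho>) * \<rho> powr \<alpha>) * I)"
    using assms kern_node[of k] by (simp add: gcoef_def ccoef_eq I_def \<rho>_def)
  also have "\<dots> = (1 - \<alpha>) * C (k - 1) (kern k) + kern k (t (k - 1))
      - (1 - \<alpha>) * ((kern k (t (k - 1)) / \<rho> powr \<alpha>) * (\<alpha> / (1 + \<rho>)) * I)"
    by (simp add: algebra_simps)
  also have "kern k (t (k - 1)) / \<rho> powr \<alpha> = kern (Suc k) (t k)"
    using kern_node_ratio[of k] assms by simp
  finally have g: "gcoef \<alpha> t n k / (1 - \<alpha>) = C (k - 1) (kern k) + kern k (t (k - 1)) / (1 - \<alpha>)
      - kern (Suc k) (t k) * (\<alpha> / (1 + \<rho>)) * I"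
    using alpha by (simp add: add_divide_distrib diff_divide_distrib)
  from sigma_cancel[of "kern k (t (k - 1))"] show ?thesis
    using assms by (simp add: S_def g ccoef_eq I_def \<rho>_def)
qed

lemma S_last_row:
  assumes "1 \<le> a" "a \<le> n"
  shows "S n n (a - 1) \<le> S n n a"
proof -
  have kern_nonneg: "0 \<le> kern k x" for k x by (simp add: kern_def)
  consider "a = 1" "n = 1" | "a = 1" "1 < n" | "2 \<le> a" "a < n" | "2 \<le> a" "a = n"
    using assms by linarith
  then show ?thesis
  proof cases
    case 1
    then show ?thesis using S_diag_1[of 1] kern_nonneg by (simp add: S_def)
  next
    case 2
    then have "kern n (t 0) \<le> A 1 (kern n)" using A_ge[OF convex_incr_kern, of 1 n] by simp
    with 2 kern_nonneg[of n "t 0"] show ?thesis by (simp add: S_def dcoef_eq C_def)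
  next
    \<comment> \<open>The chain passes through
      \<open>C (a - 1) (kern n) + kern n (t (a - 1))\<close>: balance on interval
      \<open>a - 1\<close>, then the lower bound for the mean over interval
      \<open>a\<close>.\<close>
    case 3
    then have "C (a - 1 - 1) (kern n) + A (a - 1) (kern n) \<le> C (a - 1) (kern n) + kern n (t (a - 1))"
      by (intro coefficient_balance convex_incr_kern) auto
    moreover from 3 have "kern n (t (a - 1)) \<le> A a (kern n)"
      by (intro A_ge convex_incr_kern) auto
    moreover have "a - 1 < n" using 3 by simp
    ultimately show ?thesis using 3 by (simp add: S_def dcoef_eq)
  next
    case 4
    then have "C (a - 1 - 1) (kern n) + A (a - 1) (kern n) \<le> C (a - 1) (kern n) + kern n (t (a - 1))"
      by (intro coefficient_balance convex_incr_kern) auto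
    with 4 S_diag_last[of n] S_below[of "n - 1" n n] show ?thesis by simp
  qed
qed

text \<open>Off the diagonal the entries are linear in the kernel, so consecutive rows differ by the
  same functionals at \<open>\<psi>\<close>, and the argument of \<open>S_last_row\<close>
  repeats.\<close>

lemma S_increment_antimono:
  assumes "1 \<le> a" "a \<le> k" "k < n"
  shows "S n (Suc k) a - S n (Suc k) (a - 1) \<le> S n k a - S n k (a - 1)"
proof -
  define \<psi> where "\<psi> x = kern k x - kern (Suc k) x" for x
  have \<psi>: "convex_incr (t j) \<psi>" if "j < k" for j
    using convex_incr_kern_diff[OF that] by (simp add: \<psi>_def[abs_def])
  have A: "A j (kern k) = A j (kern (Suc k)) + A j \<psi>" if "1 \<le> j" "j < k" for j
    using A_kern_diff[OF that] by (simp add: \<psi>_def[abs_def])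
  have C: "C j (kern k) = C j (kern (Suc k)) + C j \<psi>" if "j < k" for j
    using C_kern_diff[OF that] by (simp add: \<psi>_def[abs_def])
  have balance: "C (a - 1 - 1) \<psi> + A (a - 1) \<psi> \<le> C (a - 1) \<psi> + \<psi> (t (a - 1))" if "2 \<le> a"
    using that assms by (intro coefficient_balance \<psi>) auto
  consider "a = 1" "k = 1" | "a = 1" "1 < k" | "2 \<le> a" "a < k" | "2 \<le> a" "a = k"
    using assms by linarith
  then show ?thesis
  proof cases
    case 1
    then have "A 1 (kern 2) \<le> kern 2 (t 1)" by (intro A_le convex_incr_kern) auto
    with 1 show ?thesis using S_diag_1[of n] by (simp add: S_def dcoef_eq C_def numeral_2_eq_2)
  next
    case 2
    have "0 \<le> kern k (t 0) - kern (Suc k) (t 0)"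
      using tstar_le_Suc[of k] t_less_tstar[of 0 k] alpha 2
      by (auto simp: kern_def intro!: powr_mono2')
    also have "\<dots> \<le> A 1 \<psi>" using A_ge[OF \<psi>, of 1] 2 by (simp add: \<psi>_def)
    finally show ?thesis using 2 A[of 1] by (simp add: S_def dcoef_eq C_def)
  next
    case 3
    then have "\<psi> (t (a - 1)) \<le> A a \<psi>" by (intro A_ge \<psi>) auto
    moreover have "a - 1 < k" "1 \<le> a - 1" using 3 by auto
    ultimately show ?thesis using 3 balance by (simp add: S_def dcoef_eq A C)
  next
    \<comment> \<open>On interval \<open>k\<close> the kernel of row \<open>k\<close> is singular,
      so \<open>\<psi>\<close> is available only up to \<open>t (k - 1)\<close>. The entry
      \<open>A k (kern (Suc k))\<close> of the next row is therefore bounded by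
      \<open>A_next\<close>, whose remainder the diagonal of row \<open>k\<close> supplies.\<close>
    case 4
    then have k: "2 \<le> k" "k - 1 < k" "1 \<le> k - 1" by auto
    have "S n (Suc k) k - S n (Suc k) (k - 1) = C (k - 1) (kern (Suc k)) + A k (kern (Suc k))
        - (C (k - 1 - 1) (kern (Suc k)) + A (k - 1) (kern (Suc k)))"
      using k by (simp add: S_below)
    moreover have "S n k (k - 1) = C (k - 1 - 1) (kern (Suc k)) + C (k - 1 - 1) \<psi>
        + (A (k - 1) (kern (Suc k)) + A (k - 1) \<psi>)"
      using k by (simp add: S_below A C)
    moreover have "C (k - 1) (kern k) = C (k - 1) (kern (Suc k)) + C (k - 1) \<psi>"
      using k by (intro C) auto
    moreover have "\<psi> (t (k - 1)) = kern k (t (k - 1)) - kern (Suc k) (t (k - 1))"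
      by (simp add: \<psi>_def)
    ultimately show ?thesis
      using A_next[of k] balance S_diag_mid[of k n] assms 4 by simp
  qed
qed

section \<open>From the matrix to the discrete derivative at a point\<close>

lemma Lstar_row:
  assumes k: "1 \<le> k"
  shows "Lstar \<alpha> t u k x * delta u k x - gcoef \<alpha> t n k / (2 * Gamma (2 - \<alpha>)) * (delta u k x)\<^sup>2
    = (1 - \<alpha>) / (2 * Gamma (2 - \<alpha>)) *
      (S n k k * (delta u k x)\<^sup>2 + 2 * delta u k x * (\<Sum>j=1..k-1. S n k j * delta u j x))"
proof -
  define v where "v j = delta u j x" for j
  define R where "R = (\<Sum>j=1..k-1. dcoef \<alpha> t k j * v j)"
  define X where "X = kern k (t (k - 1))"
  define N where "N = (1 - \<alpha>) * (ccoef \<alpha> t k (k - 1) * v k + R) + \<sigma> * X * v k"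
  \<comment> \<open>Since the coefficient \<open>ccoef\<close> with index 0 is 0,
    \<open>dcoef\<close> at \<open>j = 1\<close> equals minus \<open>acoef\<close>, and the separate
    first term joins the sum. For \<open>k = 1\<close> both sides are 0.\<close>
  have R: "- acoef \<alpha> t k 1 * v 1 + (\<Sum>j = 2..k - 1. dcoef \<alpha> t k j * v j) = R"
  proof (cases "k = 1")
    case True
    then show ?thesis by (simp add: R_def acoef_def)
  next
    case False
    then have "{1..k - 1} = insert 1 {2..k - 1}" using k by auto
    then show ?thesis by (simp add: R_def dcoef_def ccoef_def)
  qed
  have G: "Gamma (2 - \<alpha>) = (1 - \<alpha>) * Gamma (1 - \<alpha>)"
  proof -
    have "1 - \<alpha> \<notin> \<int>\<^sub>\<le>\<^sub>0" using alpha nonpos_Ints_nonpos[of "1 - \<alpha>"] by auto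
    from Gamma_plus1[OF this] show ?thesis by (simp add: algebra_simps)
  qed
  have X: "\<sigma> powr (1 - \<alpha>) / tau t k powr \<alpha> = \<sigma> * X"
    using kern_node[OF k] sigma_bounds tau_pos[OF k]
    by (simp add: X_def powr_mult powr_diff)
  have "Lstar \<alpha> t u k x = (1 / Gamma (1 - \<alpha>)) * (ccoef \<alpha> t k (k - 1) * v k + R)
      + (\<sigma> powr (1 - \<alpha>) / tau t k powr \<alpha>) / Gamma (2 - \<alpha>) * v k"
    unfolding Lstar_def R[symmetric] v_def by (simp add: mult.commute)
  also have "1 / Gamma (1 - \<alpha>) = (1 - \<alpha>) / Gamma (2 - \<alpha>)"
    unfolding G using alpha by simp
  also have "(1 - \<alpha>) / Gamma (2 - \<alpha>) * (ccoef \<alpha> t k (k - 1) * v k + R)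
      + (\<sigma> powr (1 - \<alpha>) / tau t k powr \<alpha>) / Gamma (2 - \<alpha>) * v k = N / Gamma (2 - \<alpha>)"
    unfolding X N_def by (simp add: add_divide_distrib)
  finally have L: "Lstar \<alpha> t u k x = N / Gamma (2 - \<alpha>)" .
  have sumS: "(\<Sum>j=1..k-1. S n k j * v j) = R"
    unfolding R_def by (intro sum.cong) (auto simp: S_def)
  have Skk: "(1 - \<alpha>) * S n k k = 2 * ((1 - \<alpha>) * ccoef \<alpha> t k (k - 1) + \<sigma> * X) - gcoef \<alpha> t n k"
    using alpha k by (simp add: S_def X_def right_diff_distrib distrib_left)
  have "(1 - \<alpha>) * (S n k k * (v k)\<^sup>2 + 2 * v k * R)
      = (1 - \<alpha>) * S n k k * (v k)\<^sup>2 + 2 * (1 - \<alpha>) * v k * R"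
    by (simp add: distrib_left)
  also have "\<dots> = 2 * N * v k - gcoef \<alpha> t n k * (v k)\<^sup>2"
    unfolding Skk N_def by (simp add: power2_eq_square algebra_simps)
  finally have "(1 - \<alpha>) / (2 * Gamma (2 - \<alpha>)) * (S n k k * (v k)\<^sup>2 + 2 * v k * R)
      = (2 * N * v k - gcoef \<alpha> t n k * (v k)\<^sup>2) / (2 * Gamma (2 - \<alpha>))"
    by (simp only: times_divide_eq_left)
  also have "\<dots> = Lstar \<alpha> t u k x * v k - gcoef \<alpha> t n k / (2 * Gamma (2 - \<alpha>)) * (v k)\<^sup>2"
    unfolding L by (simp add: diff_divide_distrib)
  finally show ?thesis unfolding v_def[symmetric] sumS by simp
qed

lemma pointwise_stability:
  "(\<Sum>k=1..n. gcoef \<alpha> t n k / (2 * Gamma (2 - \<alpha>)) * (delta u k x)\<^sup>2)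
     \<le> (\<Sum>k=1..n. Lstar \<alpha> t u k x * delta u k x)"
proof -
  have "0 \<le> (\<Sum>k=1..n. S n k k * (delta u k x)\<^sup>2
      + 2 * delta u k x * (\<Sum>j=1..k-1. S n k j * delta u j x))"
    by (intro quadratic_form_nonneg S_last_row S_increment_antimono) (auto simp: S_def)
  then have "0 \<le> (1 - \<alpha>) / (2 * Gamma (2 - \<alpha>)) * \<dots>"
    using alpha Gamma_real_pos[of "2 - \<alpha>"] by (intro mult_nonneg_nonneg) auto
  also have "\<dots> = (\<Sum>k=1..n. Lstar \<alpha> t u k x * delta u k x
      - gcoef \<alpha> t n k / (2 * Gamma (2 - \<alpha>)) * (delta u k x)\<^sup>2)"
    unfolding sum_distrib_left[where r = "(1 - \<alpha>) / (2 * Gamma (2 - \<alpha>))"]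
    by (intro sum.cong refl Lstar_row[symmetric]) simp
  finally show ?thesis by (simp add: sum_subtractf)
qed

end

section \<open>Integration over the domain\<close>

lemma in_L2_mult:
  assumes f: "in_L2 \<Omega> f" and g: "in_L2 \<Omega> g"
  shows "set_integrable lborel \<Omega> (\<lambda>x. f x * g x)"
proof -
  have "integrable lborel (\<lambda>x. indicator \<Omega> x *\<^sub>R (f x)\<^sup>2 + indicator \<Omega> x *\<^sub>R (g x)\<^sup>2)"
    using f g unfolding in_L2_def set_integrable_def by (intro Bochner_Integration.integrable_add) auto
  \<comment> \<open>Each factor keeps its own indicator, because \<open>in_L2\<close> gives
    measurability only of that product; the indicator is its own square.\<close>
  then have "integrable lborel (\<lambda>x. (indicator \<Omega> x * f x) * (indicator \<Omega> x * g x))"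
  proof (rule Bochner_Integration.integrable_bound)
    have "(\<lambda>x. indicator \<Omega> x * f x) \<in> borel_measurable lborel"
      "(\<lambda>x. indicator \<Omega> x * g x) \<in> borel_measurable lborel"
      using f g unfolding in_L2_def by auto
    then show "(\<lambda>x. (indicator \<Omega> x * f x) * (indicator \<Omega> x * g x)) \<in> borel_measurable lborel"
      by (rule borel_measurable_times)
    have "\<bar>f x * g x\<bar> \<le> (f x)\<^sup>2 + (g x)\<^sup>2" for x
    proof -
      have "0 \<le> \<bar>f x\<bar> * \<bar>g x\<bar>" by simp
      then show ?thesis
        using sum_squares_bound[of "\<bar>f x\<bar>" "\<bar>g x\<bar>"] unfolding abs_mult power2_abs by linarith
    qed
    then show "AE x in lborel. norm ((indicator \<Omega> x * f x) * (indicator \<Omega> x * g x))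
        \<le> norm (indicator \<Omega> x *\<^sub>R (f x)\<^sup>2 + indicator \<Omega> x *\<^sub>R (g x)\<^sup>2)"
      by (intro AE_I2) (auto simp: indicator_def)
  qed
  moreover have "(\<lambda>x. (indicator \<Omega> x * f x) * (indicator \<Omega> x * g x)) = (\<lambda>x. indicator \<Omega> x *\<^sub>R (f x * g x))"
    by (auto simp: indicator_def)
  ultimately show ?thesis by (simp add: set_integrable_def)
qed

lemma set_integrable_sum:
  fixes f :: "'i \<Rightarrow> 'a \<Rightarrow> real"
  assumes "\<And>i. i \<in> I \<Longrightarrow> set_integrable M A (f i)"
  shows "set_integrable M A (\<lambda>x. \<Sum>i\<in>I. f i x)"
  using Bochner_Integration.integrable_sum[of I M "\<lambda>i x. indicator A x *\<^sub>R f i x"] assms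
  by (simp add: set_integrable_def sum_distrib_left)

lemma set_integral_sum:
  fixes f :: "'i \<Rightarrow> 'a \<Rightarrow> real"
  assumes "\<And>i. i \<in> I \<Longrightarrow> set_integrable M A (f i)"
  shows "(LINT x:A|M. (\<Sum>i\<in>I. f i x)) = (\<Sum>i\<in>I. LINT x:A|M. f i x)"
  using Bochner_Integration.integral_sum[of I M "\<lambda>i x. indicator A x *\<^sub>R f i x"] assms
  by (simp add: set_integrable_def set_lebesgue_integral_def sum_distrib_left)

lemma delta_mult_integrable:
  assumes "\<forall>j. in_L2 \<Omega> (u j)"
  shows "set_integrable lborel \<Omega> (\<lambda>x. delta u i x * delta u j x)"
proof -
  have "set_integrable lborel \<Omega> (\<lambda>x. (u i x * u j x - u i x * u (j - 1) x)
     - (u (i - 1) x * u j x - u (i - 1) x * u (j - 1) x))"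
    using assms by (intro set_integral_diff in_L2_mult) auto
  then show ?thesis by (simp add: delta_def algebra_simps)
qed

lemma Lstar_delta_integrable:
  assumes "\<forall>j. in_L2 \<Omega> (u j)"
  shows "set_integrable lborel \<Omega> (\<lambda>x. Lstar \<alpha> t u k x * delta u k x)"
proof -
  define G where "G = 1 / Gamma (1 - \<alpha>)"
  have "set_integrable lborel \<Omega> (\<lambda>x.
       (G * ccoef \<alpha> t k (k - 1)) * (delta u k x * delta u k x)
     - (G * acoef \<alpha> t k 1) * (delta u 1 x * delta u k x)
     + (\<Sum>j = 2..k - 1. (G * dcoef \<alpha> t k j) * (delta u j x * delta u k x))
     + sigma \<alpha> powr (1 - \<alpha>) / (Gamma (2 - \<alpha>) * tau t k powr \<alpha>) * (delta u k x * delta u k x))"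
    by (intro set_integral_add set_integral_diff set_integrable_sum set_integrable_mult_right
        delta_mult_integrable assms)
  moreover have "(\<Sum>j = 2..k - 1. (G * dcoef \<alpha> t k j) * (delta u j x * delta u k x))
      = G * (\<Sum>j = 2..k - 1. dcoef \<alpha> t k j * delta u j x) * delta u k x" for x
    by (simp add: sum_distrib_left sum_distrib_right mult.assoc)
  ultimately show ?thesis
    by (simp add: Lstar_def G_def[symmetric] algebra_simps)
qed

section \<open>The mesh thresholds\<close>

text \<open>The polynomial is strictly increasing on the nonnegative axis, so the intermediate value
  theorem gives the root and monotonicity its uniqueness. \<open>a = 1\<close> is the equation of
  \<open>rho_star\<close>, \<open>a = 0\<close> that of \<open>eta\<close>; the point
  \<open>y\<close> becomes a strict lower bound for the root.\<close>

lemma cubic_unique_root: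
  fixes a :: real
  assumes a: "0 \<le> a" and y: "0 \<le> y" "y < z" "a * (y * (1 + y)) + 3 * y\<^sup>2 * (1 + y) < 1"
    "1 < a * (z * (1 + z)) + 3 * z\<^sup>2 * (1 + z)"
  shows "\<exists>r>y. a * (r * (1 + r)) + 3 * r\<^sup>2 * (1 + r) = 1
    \<and> (\<forall>s>0. a * (s * (1 + s)) + 3 * s\<^sup>2 * (1 + s) = 1 \<longrightarrow> s = r)"
proof -
  define p where "p x = a * (x * (1 + x)) + 3 * x\<^sup>2 * (1 + x)" for x
  have mono: "p x < p w" if "0 \<le> x" "x < w" for x w
  proof -
    have "x\<^sup>2 * (1 + x) < w\<^sup>2 * (1 + w)"
      using that by (intro mult_strict_mono power_strict_mono) auto
    moreover have "a * (x * (1 + x)) \<le> a * (w * (1 + w))"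
      using that a by (intro mult_left_mono mult_mono) auto
    ultimately show ?thesis by (simp add: p_def)
  qed
  have "\<exists>r\<ge>y. r \<le> z \<and> p r = 1"
    using y by (intro IVT') (auto simp: p_def intro!: continuous_intros)
  then obtain r where r: "y \<le> r" "p r = 1" by blast
  have "y < r" using r y by (cases "y = r") (auto simp: p_def)
  then have "0 < r" using y by simp
  have "s = r" if "0 < s" "p s = 1" for s
    using mono[of s r] mono[of r s] that r \<open>0 < r\<close> by (cases s r rule: linorder_cases) auto
  with \<open>y < r\<close> r(2) show ?thesis unfolding p_def by blast
qed

lemma rho_star_gt: "1/3 < rho_star"
proof -
  have "\<exists>r>1/3. 1 * (r * (1 + r)) + 3 * r\<^sup>2 * (1 + r) = (1::real)
      \<and> (\<forall>s>0. 1 * (s * (1 + s)) + 3 * s\<^sup>2 * (1 + s) = 1 \<longrightarrow> s = r)"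
    \<comment> \<open>The polynomial is \<open>8/9\<close> at \<open>1/3\<close> and
      \<open>8\<close> at \<open>1\<close>.\<close>
    by (rule cubic_unique_root[of 1 "1/3" 1]) (auto simp: power2_eq_square)
  then obtain r :: real where r: "1/3 < r" "r * (1 + r) + 3 * r\<^sup>2 * (1 + r) = 1"
    "\<And>s. 0 < s \<Longrightarrow> s * (1 + s) + 3 * s\<^sup>2 * (1 + s) = 1 \<Longrightarrow> s = r"
    unfolding mult_1 by blast
  have "rho_star = r" unfolding rho_star_def
  proof (rule the_equality)
    show "0 < r \<and> r * (1 + r) = 1 - 3 * r\<^sup>2 * (1 + r)" using r(1,2) by linarith
    show "s = r" if "0 < s \<and> s * (1 + s) = 1 - 3 * s\<^sup>2 * (1 + s)" for s
      using that by (intro r(3)) linarith+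
  qed
  with r(1) show ?thesis by simp
qed

text \<open>Translates a positive denominator in the mesh hypothesis into the threshold
  \<open>eta\<close>: the root exceeds the lower point \<open>\<rho>\<close>, and \<open>1\<close>
  is the upper point, with value \<open>6\<close>.\<close>

lemma eta_bound:
  assumes "0 < \<rho>" "3 * \<rho>\<^sup>2 * (1 + \<rho>) < 1"
  shows "\<rho> < eta"
proof -
  have "\<rho> < 1"
  proof (rule ccontr)
    assume "\<not> \<rho> < 1"
    then have "1 * 2 \<le> \<rho>\<^sup>2 * (1 + \<rho>)" by (intro mult_mono) (auto simp: one_le_power)
    with assms show False by simp
  qed
  have "\<exists>r>\<rho>. 0 * (r * (1 + r)) + 3 * r\<^sup>2 * (1 + r) = 1
      \<and> (\<forall>s>0. 0 * (s * (1 + s)) + 3 * s\<^sup>2 * (1 + s) = 1 \<longrightarrow> s = r)"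
  proof (rule cubic_unique_root)
    show "0 * (\<rho> * (1 + \<rho>)) + 3 * \<rho>\<^sup>2 * (1 + \<rho>) < 1" using assms(2) by simp
    show "\<rho> < 1" by fact
  qed (use assms(1) in auto)
  then obtain r :: real where r: "\<rho> < r" "3 * r\<^sup>2 * (1 + r) = 1"
    "\<And>s. 0 < s \<Longrightarrow> 3 * s\<^sup>2 * (1 + s) = 1 \<Longrightarrow> s = r"
    unfolding mult_zero_left add_0 by blast
  have "eta = r" unfolding eta_def
  proof (rule the_equality)
    show "0 < r \<and> 1 - 3 * r\<^sup>2 * (1 + r) = 0" using r(1,2) assms(1) by linarith
    show "s = r" if "0 < s \<and> 1 - 3 * s\<^sup>2 * (1 + s) = 0" for s
      using that by (intro r(3)) linarith+
  qed
  with r(1) show ?thesis by simp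
qed

theorem theorem1:
  fixes \<alpha> :: real and t :: "nat \<Rightarrow> real" and \<Omega> :: "'a::euclidean_space set"
    and u :: "nat \<Rightarrow> 'a \<Rightarrow> real" and n :: nat
  assumes alpha: "0 < \<alpha>" "\<alpha> < 1"
    and dom: "lipschitz_domain \<Omega>"
    and t0: "t 0 = 0" and tmono: "strict_mono t"
    and rho_gt: "\<forall>k\<ge>2. rho_star < ratio t k"
    and mesh1: "\<forall>k\<ge>2. rho_star < ratio t k \<and> ratio t k < eta \<longrightarrow>
                   rho_star < ratio t (k + 1) \<and>
                   ratio t (k + 1) \<le> (ratio t k)\<^sup>2 * (1 + ratio t k) / (1 - 3 * (ratio t k)\<^sup>2 * (1 + ratio t k))"
    and mesh2: "\<forall>k\<ge>2. eta \<le> ratio t k \<longrightarrow> rho_star < ratio t (k + 1)"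
    and uL2: "\<forall>j. in_L2 \<Omega> (u j)"
    and n: "1 \<le> n"
  shows "Bform \<alpha> t \<Omega> u n \<ge>
           (\<Sum>k = 1..n. gcoef \<alpha> t n k / (2 * Gamma (2 - \<alpha>)) * L2_norm_sq \<Omega> (delta u k))
      \<and> (\<Sum>k = 1..n. gcoef \<alpha> t n k / (2 * Gamma (2 - \<alpha>)) * L2_norm_sq \<Omega> (delta u k)) \<ge> 0
      \<and> (\<forall>k\<in>{1..n}. gcoef \<alpha> t n k > 0)"
proof -
  have ratio_gt: "1/3 < ratio t k" if "2 \<le> k" for k
    using rho_gt rho_star_gt that by force
  interpret frac_mesh \<alpha> t
  proof
    fix k :: nat assume k: "2 \<le> k"
    define \<rho> where "\<rho> = ratio t k"
    define r where "r = ratio t (k + 1)"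
    define P where "P = \<rho>\<^sup>2 * (1 + \<rho>)"
    have pos: "0 < \<rho>" "0 < r" using ratio_gt[of k] ratio_gt[of "k + 1"] k by (auto simp: \<rho>_def r_def)
    then have P: "0 < P" by (simp add: P_def)
    show "1 / ((ratio t k)\<^sup>2 * (1 + ratio t k)) \<le> 3 + 1 / ratio t (k + 1)"
    \<comment> \<open>The split is by the sign of the denominator \<open>1 - 3 * P\<close>. If it is
      positive, the mesh bound reads \<open>r * (1 - 3 * P) \<le> P\<close>, to be divided by
      \<open>r * P\<close>; otherwise \<open>1 / P\<close> is at most \<open>3\<close>.\<close>
    proof (cases "3 * P < 1")
      case True
      then have "\<rho> < eta" using pos by (intro eta_bound) (auto simp: P_def)
      then have "r \<le> P / (1 - 3 * P)"
        using mesh1 rho_gt k by (simp add: P_def r_def \<rho>_def mult.assoc)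
      then have "r * (1 - 3 * P) \<le> P" using True by (simp add: pos_le_divide_eq)
      then have "1 / P \<le> 3 + 1 / r" using P pos by (simp add: field_simps)
      then show ?thesis by (simp add: P_def \<rho>_def r_def)
    next
      case False
      then have "1 / P \<le> 3" using P by (simp add: field_simps)
      moreover have "0 < 1 / r" using pos by simp
      ultimately have "1 / P \<le> 3 + 1 / r" by linarith
      then show ?thesis by (simp add: P_def \<rho>_def r_def)
    qed
  qed (use alpha tmono ratio_gt in auto)
  define w where "w k = gcoef \<alpha> t n k / (2 * Gamma (2 - \<alpha>))" for k
  have w: "0 < w k" if "k \<in> {1..n}" for k
    using gcoef_pos[of k n] that Gamma_real_pos[of "2 - \<alpha>"] alpha by (simp add: w_def)
  have sq: "set_integrable lborel \<Omega> (\<lambda>x. (delta u k x)\<^sup>2)" for k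
    using delta_mult_integrable[OF uL2] by (simp add: power2_eq_square)
  have "(\<Sum>k = 1..n. w k * L2_norm_sq \<Omega> (delta u k)) = (LINT x:\<Omega>|lborel. (\<Sum>k=1..n. w k * (delta u k x)\<^sup>2))"
    by (simp add: set_integral_sum sq set_integrable_mult_right L2_norm_sq_def)
  also have "\<dots> \<le> (LINT x:\<Omega>|lborel. (\<Sum>k=1..n. Lstar \<alpha> t u k x * delta u k x))"
    using pointwise_stability[of n u] unfolding w_def
    by (intro set_integral_mono set_integrable_sum set_integrable_mult_right sq
        Lstar_delta_integrable uL2) auto
  also have "\<dots> = Bform \<alpha> t \<Omega> u n"
    by (simp add: set_integral_sum Lstar_delta_integrable uL2 Bform_def L2_inner_def)
  finally have 1: "(\<Sum>k = 1..n. w k * L2_norm_sq \<Omega> (delta u k)) \<le> Bform \<alpha> t \<Omega> u n" .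
  have "0 \<le> L2_norm_sq \<Omega> (delta u k)" for k
    unfolding L2_norm_sq_def set_lebesgue_integral_def by (intro Bochner_Integration.integral_nonneg) auto
  then have 2: "0 \<le> (\<Sum>k = 1..n. w k * L2_norm_sq \<Omega> (delta u k))"
    using w by (intro sum_nonneg mult_nonneg_nonneg) (auto simp: less_imp_le)
  from 1 2 show ?thesis unfolding w_def using gcoef_pos by auto
qed

end
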